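(* Let $M_1,M_2$ be positive integers, $\alpha>0$ and $t\ge0$. Let $\eta_t$ be the one-shock half-line open TASEP with boundary rate $\alpha$ described in the context, with $f(t)$ the position of its unique second-class particle, and let $\mathcal{N}(x,t)$ be the number of particles at sites $\ge x$ at time $t$ in the standard half-line open TASEP with boundary rate $\alpha$ started from the empty configuration. Then $$\mathbb{P}(f(t)<0)=\mathbb{P}\big(\mathcal{N}(1,t)-\mathcal{N}(M_1+M_2+2,t)\ge M_1+1\big).$$ Equivalently, $$\mathbb{P}(f(t)>0)=\mathbb{P}\big(\mathcal{N}(1,t)-\mathcal{N}(M_1+M_2+2,t)\le M_1\big).$$
   Context: Multi-color half-line open TASEP: a continuous-time Markov process on configurations $\eta:\mathbb{Z}_{>0}\to\{1,2,+\infty\}$, where $1$ denotes a first-class particle, $2$ a second-class particle and $+\infty$ a hole. Dynamics: independently for each $x\ge1$, at rate $1$ the contents of sites $x$ and $x+1$ are exchanged if $\eta(x)<\eta(x+1)$ (nothing happens otherwise); at rate $\alpha$, if $\eta(1)>1$, the content of site $1$ is replaced by a first-class particle (nothing happens otherwise). In particular, a second-class particle at site $1$ that is replaced in this way leaves the system permanently. Initial condition of $\eta_t$: $\eta_0(x)=+\infty$ for $1\le x\le M_1$; $\eta_0(M_1+1)=2$; $\eta_0(x)=1$ for $M_1+2\le x\le M_1+M_2+1$; $\eta_0(x)=+\infty$ for $x>M_1+M_2+1$. $f(t)$ is the position of the unique second-class particle of $\eta_t$; $f(t)>0$ means that this particle is still in the system at time $t$, and $f(t)<0$ means that it has left (disappeared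 from) the system by time $t$. Standard half-line open TASEP with step initial condition: the same dynamics with only first-class particles and holes, started with all sites of $\mathbb{Z}_{>0}$ empty (holes); $\mathcal{N}(x,t)$ is the number of its particles at sites $\ge x$ at time $t$. *)

theory Defs
  imports "HOL-Probability.Probability"
begin

section \<open>Markov processes in continuous time\<close>

definition markov_semigroup :: "'s measure \<Rightarrow> (real \<Rightarrow> 's \<Rightarrow> 's measure) \<Rightarrow> bool" where
  "markov_semigroup S P \<longleftrightarrow>
     (\<forall>t\<ge>0. P t \<in> measurable S (prob_algebra S)) \<and>
     (\<forall>x\<in>space S. P 0 x = return S x) \<and>
     (\<forall>s\<ge>0. \<forall>t\<ge>0. \<forall>x\<in>space S. P (s + t) x = bind (P s x) (P t))"

definition past :: "'w measure \<Rightarrow> 's measure \<Rightarrow> (real \<Rightarrow> 'w \<Rightarrow> 's) \<Rightarrow> real \<Rightarrow> 'w measure" where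
  "past M S X s = sigma (space M) {X u -` A \<inter> space M | u A. 0 \<le> u \<and> u \<le> s \<and> A \<in> sets S}"

definition markov_process ::
  "'w measure \<Rightarrow> 's measure \<Rightarrow> (real \<Rightarrow> 's \<Rightarrow> 's measure) \<Rightarrow> 's \<Rightarrow> (real \<Rightarrow> 'w \<Rightarrow> 's) \<Rightarrow> bool" where
  "markov_process M S P x0 X \<longleftrightarrow>
     prob_space M \<and>
     (\<forall>t\<ge>0. X t \<in> measurable M S) \<and>
     (AE \<omega> in M. X 0 \<omega> = x0) \<and>
     (\<forall>s\<ge>0. \<forall>t\<ge>0. \<forall>A\<in>sets S. AE \<omega> in M.
        real_cond_exp M (past M S X s) (indicator (X (s + t) -` A \<inter> space M)) \<omega>
          = measure (P t (X s \<omega>)) A)"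


section \<open>The half-line open TASEP\<close>

text \<open>A configuration assigns contents to the sites 1, 2, 3, \<dots>. The contents are
  extended natural numbers: \<open>1\<close> is a first-class particle, \<open>2\<close> a second-class particle and
  \<open>\<infinity>\<close> a hole. The set \<open>C\<close> of admissible contents is a parameter, so that the
  two-colour process (\<open>C = {1, 2, \<infinity>}\<close>) and the standard process
  (\<open>C = {1, \<infinity>}\<close>) obey the same dynamics. Configurations are extensional
  functions: the value at the index \<open>0\<close>, which is not a site, is \<open>undefined\<close>.\<close>

type_synonym config = "nat \<Rightarrow> enat"

definition config_space :: "enat set \<Rightarrow> config measure" where
  "config_space C = PiM {1..} (\<lambda>_. count_space C)"

definition exchange :: "nat \<Rightarrow> config \<Rightarrow> config" where
  "exchange x \<eta> = (if \<eta> x < \<eta> (x + 1) then \<eta>(x := \<eta> (x + 1), x + 1 := \<eta> x) else \<eta>)"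

definition inject :: "config \<Rightarrow> config" where
  "inject \<eta> = (if \<eta> 1 > 1 then \<eta>(1 := 1) else \<eta>)"

definition local_function :: "enat set \<Rightarrow> (config \<Rightarrow> real) \<Rightarrow> bool" where
  "local_function C g \<longleftrightarrow>
     (\<exists>n. \<forall>\<eta>\<in>space (config_space C). \<forall>\<xi>\<in>space (config_space C).
        (\<forall>x\<in>{1..n}. \<eta> x = \<xi> x) \<longrightarrow> g \<eta> = g \<xi>)"

text \<open>For a local function only finitely many summands are nonzero.\<close>

definition tasep_generator :: "real \<Rightarrow> (config \<Rightarrow> real) \<Rightarrow> config \<Rightarrow> real" where
  "tasep_generator \<alpha> g \<eta> =
     \<alpha> * (g (inject \<eta>) - g \<eta>) + (\<Sum>\<^sub>\<infinity>x\<in>{1..}. (g (exchange x \<eta>) - g \<eta>))"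

text \<open>The rates of the dynamics are expressed as usual for interacting particle systems: on
  local functions, the infinitesimal generator of the semigroup (a limit in the supremum norm) is
  \<open>tasep_generator\<close>. The contents being finitely many, this determines the semigroup.
  The last conjunct says that the content of each site is a right-continuous
  step function of time with left limits.\<close>

definition half_line_open_tasep ::
  "enat set \<Rightarrow> real \<Rightarrow> config \<Rightarrow> 'w measure \<Rightarrow> (real \<Rightarrow> 'w \<Rightarrow> config) \<Rightarrow> bool" where
  "half_line_open_tasep C \<alpha> \<eta>0 M X \<longleftrightarrow>
     (\<exists>P. markov_semigroup (config_space C) P \<and>
          (\<forall>g. local_function C g \<longrightarrow>
             uniform_limit (space (config_space C))
               (\<lambda>h \<eta>. ((\<integral>\<xi>. g \<xi> \<partial>P h \<eta>) - g \<eta>) / h) (tasep_generator \<alpha> g) (at_right 0)) \<and>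
          markov_process M (config_space C) P \<eta>0 X) \<and>
     (AE \<omega> in M. \<forall>x\<ge>1. \<forall>t\<ge>0.
        (\<forall>\<^sub>F s in at_right t. X s \<omega> x = X t \<omega> x) \<and>
        (t > 0 \<longrightarrow> (\<exists>c. \<forall>\<^sub>F s in at_left t. X s \<omega> x = c)))"

definition one_shock_config :: "nat \<Rightarrow> nat \<Rightarrow> config" where
  "one_shock_config M1 M2 = (\<lambda>x\<in>{1..}.
     if x \<le> M1 then \<infinity>
     else if x = M1 + 1 then 2
     else if x \<le> M1 + M2 + 1 then 1
     else \<infinity>)"

definition empty_config :: config where
  "empty_config = (\<lambda>x\<in>{1..}. \<infinity>)"

text \<open>A particle that has left the system is given the position \<open>-1\<close>; only the sign
  of this value carries meaning. Choosing the least position (rather than a definite description)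
  makes no difference when there is only one second-class particle, and keeps the
  function measurable on all configurations.\<close>

definition second_class_position :: "config \<Rightarrow> int" where
  "second_class_position \<eta> =
     (if \<exists>x\<ge>1. \<eta> x = 2 then int (LEAST x. x \<ge> 1 \<and> \<eta> x = 2) else -1)"

definition particles_from :: "nat \<Rightarrow> config \<Rightarrow> nat" where
  "particles_from x \<eta> = card {y. y \<ge> 1 \<and> y \<ge> x \<and> \<eta> y \<noteq> \<infinity>}"

end

theory Submission
  imports Defs
begin

text \<open>
  The half-line open TASEP is self-dual. For configurations \<open>\<eta>\<close>, \<open>\<zeta>\<close> let \<open>h\<close> count the
  particles to the right of a site and put
  \<open>D(\<eta>, \<zeta>) = min\<^bsub>z\<ge>0\<^esub> (z + h\<^bsub>\<eta>\<^esub>(z) + h\<^bsub>\<zeta>\<^esub>(z))\<close>. A jump across the bond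
  \<open>(x, x + 1)\<close>, or an injection for \<open>x = 0\<close>, raises \<open>h\<close> by one at \<open>x\<close> only, and it changes the
  minimum only if the same move is possible in the other configuration as well; hence each
  move can be transferred from \<open>\<eta>\<close> to \<open>\<zeta>\<close>, and \<open>E D(\<eta>\<^sub>t, \<zeta>\<^sub>0) = E D(\<eta>\<^sub>0, \<zeta>\<^sub>t)\<close>.

  Treating the second-class particle once as a particle and once as a hole gives two
  single-species processes. If \<open>\<zeta>\<^sub>0\<close> is empty, the difference of their functions \<open>D(\<eta>\<^sub>t, \<zeta>\<^sub>0)\<close>
  is the number of second-class particles still present, and the difference of their functions
  \<open>D(\<eta>\<^sub>0, \<zeta>\<^sub>t)\<close> is the indicator that \<open>\<zeta>\<^sub>t\<close> has at most \<open>M\<^sub>1\<close> particles in \<open>{1..M\<^sub>1 + M\<^sub>2 + 1}\<close>.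

  To remain within local functions, \<open>D\<close> is truncated to the sites \<open>{1..n}\<close>. The only error
  then comes from the bond \<open>(n, n + 1)\<close>; it requires a particle at \<open>n\<close>, which has probability at
  most \<open>t\<^sup>k / k!\<close> if initially there are no particles beyond \<open>n - k\<close>.
\<close>

section \<open>Local functions\<close>

text \<open>Unlike in \<open>local_function\<close> the range \<open>n\<close> is explicit, so that
  its growth under the generator can be followed.\<close>

definition local_on :: "enat set \<Rightarrow> nat \<Rightarrow> (config \<Rightarrow> real) \<Rightarrow> bool" where
  "local_on C n g \<longleftrightarrow>
     (\<forall>\<eta>\<in>space (config_space C). \<forall>\<xi>\<in>space (config_space C).
        (\<forall>x\<in>{1..n}. \<eta> x = \<xi> x) \<longrightarrow> g \<eta> = g \<xi>)"

lemma local_onI: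
  assumes "\<And>\<eta> \<xi>. \<eta> \<in> space (config_space C) \<Longrightarrow> \<xi> \<in> space (config_space C) \<Longrightarrow>
             (\<And>x. 1 \<le> x \<Longrightarrow> x \<le> n \<Longrightarrow> \<eta> x = \<xi> x) \<Longrightarrow> g \<eta> = g \<xi>"
  shows "local_on C n g"
proof -
  have "g \<eta> = g \<xi>" if "\<eta> \<in> space (config_space C)" "\<xi> \<in> space (config_space C)"
    "\<forall>x\<in>{1..n}. \<eta> x = \<xi> x" for \<eta> \<xi>
    by (rule assms[OF that(1,2)]) (use that(3) in simp)
  then show ?thesis unfolding local_on_def by blast
qed

lemma local_onD:
  assumes "local_on C n g" "\<eta> \<in> space (config_space C)" "\<xi> \<in> space (config_space C)"
    and "\<And>x. 1 \<le> x \<Longrightarrow> x \<le> n \<Longrightarrow> \<eta> x = \<xi> x"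
  shows "g \<eta> = g \<xi>"
proof -
  have "\<forall>x\<in>{1..n}. \<eta> x = \<xi> x" using assms(4) by simp
  with assms(1-3) show ?thesis unfolding local_on_def by blast
qed

lemma local_on_imp_local: "local_on C n g \<Longrightarrow> local_function C g"
  unfolding local_on_def local_function_def by (rule exI)

lemma local_on_mono:
  assumes "local_on C n g" "n \<le> m"
  shows "local_on C m g"
proof (rule local_onI)
  fix \<eta> \<xi> assume "\<eta> \<in> space (config_space C)" "\<xi> \<in> space (config_space C)"
    and "\<And>x. 1 \<le> x \<Longrightarrow> x \<le> m \<Longrightarrow> \<eta> x = \<xi> x"
  then show "g \<eta> = g \<xi>"
    using assms(2) by (intro local_onD[OF assms(1)]) simp_all
qed

text \<open>A canonical representative of all configurations agreeing on \<open>{1..n}\<close>.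
  Filling up with holes gives again a configuration, which a restriction to \<open>{1..n}\<close>
  would not be.\<close>

definition pad :: "nat \<Rightarrow> config \<Rightarrow> config" where
  "pad n \<eta> = (\<lambda>x\<in>{1..}. if x \<le> n then \<eta> x else \<infinity>)"

lemma space_config: "space (config_space C) = (\<Pi>\<^sub>E x\<in>{1..}. C)"
  by (simp add: config_space_def space_PiM)

lemma config_value:
  assumes "\<eta> \<in> space (config_space C)" "x \<ge> 1"
  shows "\<eta> x \<in> C"
  using assms by (auto simp: space_config)

lemma pad_eq_iff: "pad n \<eta> = pad n \<xi> \<longleftrightarrow> (\<forall>x\<in>{1..n}. \<eta> x = \<xi> x)"
proof
  assume eq: "pad n \<eta> = pad n \<xi>"
  show "\<forall>x\<in>{1..n}. \<eta> x = \<xi> x"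
  proof
    fix x assume "x \<in> {1..n}"
    then show "\<eta> x = \<xi> x" using fun_cong[OF eq, of x] by (simp add: pad_def)
  qed
qed (auto simp: pad_def)

lemma pad_in_space: "\<infinity> \<in> C \<Longrightarrow> \<eta> \<in> space (config_space C) \<Longrightarrow> pad n \<eta> \<in> space (config_space C)"
  by (auto simp: space_config pad_def)

lemma local_on_pad:
  "\<infinity> \<in> C \<Longrightarrow> local_on C n g \<Longrightarrow> \<eta> \<in> space (config_space C) \<Longrightarrow> g (pad n \<eta>) = g \<eta>"
  by (rule local_onD[of C n g]) (simp_all add: pad_in_space, simp add: pad_def)

text \<open>With finitely many contents a window has finitely many patterns. So a local function
  takes finitely many values, and the expansions over patterns are finite sums.\<close>

lemma finite_pad_image:
  assumes "finite C"
  shows "finite (pad n ` space (config_space C))"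
proof (rule finite_subset)
  show "pad n ` space (config_space C) \<subseteq>
      (\<lambda>p. \<lambda>x\<in>{1..}. if x \<le> n then p x else \<infinity>) ` ({1..n} \<rightarrow>\<^sub>E C)"
  proof
    fix \<xi> assume "\<xi> \<in> pad n ` space (config_space C)"
    then obtain \<eta> where \<eta>: "\<eta> \<in> space (config_space C)" "\<xi> = pad n \<eta>" by auto
    have "\<xi> = (\<lambda>p. \<lambda>x\<in>{1..}. if x \<le> n then p x else \<infinity>) (restrict \<eta> {1..n})"
      unfolding \<eta>(2) pad_def by (rule ext) simp
    moreover have "restrict \<eta> {1..n} \<in> {1..n} \<rightarrow>\<^sub>E C"
      using config_value[OF \<eta>(1)] by auto
    ultimately show "\<xi> \<in> (\<lambda>p. \<lambda>x\<in>{1..}. if x \<le> n then p x else \<infinity>) ` ({1..n} \<rightarrow>\<^sub>E C)"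
      by (rule image_eqI)
  qed
  show "finite ((\<lambda>p. \<lambda>x\<in>{1..}. if x \<le> n then p x else \<infinity>) ` ({1..n} \<rightarrow>\<^sub>E C))"
    using assms by (intro finite_imageI finite_PiE) auto
qed

lemma site_measurable:
  assumes "x \<ge> 1"
  shows "(\<lambda>\<eta>. \<eta> x) \<in> measurable (config_space C) (count_space C)"
  unfolding config_space_def by (rule measurable_component_singleton) (use assms in auto)

lemma pred_site [measurable]:
  assumes "x \<ge> 1"
  shows "Measurable.pred (config_space C) (\<lambda>\<eta>. Q (\<eta> x))"
  by (rule measurable_compose[OF site_measurable[OF assms]]) simp

text \<open>The target carries the discrete sigma-algebra, so every function of \<open>pad n\<close>
  is measurable; by \<open>local_on_pad\<close> this covers the functions of range
  \<open>n\<close>.\<close>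

lemma pad_measurable:
  assumes "finite C"
  shows "pad n \<in> measurable (config_space C) (count_space (pad n ` space (config_space C)))"
proof (subst measurable_count_space_eq2[OF finite_pad_image[OF assms]], intro conjI ballI)
  show "pad n \<in> space (config_space C) \<rightarrow> pad n ` space (config_space C)" by auto
next
  fix \<xi> assume "\<xi> \<in> pad n ` space (config_space C)"
  then obtain \<eta>' where \<eta>': "\<eta>' \<in> space (config_space C)" "\<xi> = pad n \<eta>'" by auto
  have "pad n -` {\<xi>} \<inter> space (config_space C) =
      {\<eta> \<in> space (config_space C). \<forall>x\<in>{1..n}. \<eta> x = \<xi> x}"
    by (auto simp: \<eta>'(2) pad_eq_iff) (simp_all add: pad_def)
  also have "\<dots> \<in> sets (config_space C)"
    by (intro sets.sets_Collect_finite_All predE pred_site) auto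
  finally show "pad n -` {\<xi>} \<inter> space (config_space C) \<in> sets (config_space C)" .
qed

lemma local_on_measurable:
  assumes "finite C" "\<infinity> \<in> C" "local_on C n g"
  shows "g \<in> borel_measurable (config_space C)"
proof -
  have "(\<lambda>\<eta>. g (pad n \<eta>)) \<in> borel_measurable (config_space C)"
    by (rule measurable_compose[OF pad_measurable[OF assms(1)]]) simp
  then show ?thesis
    by (rule measurable_cong[THEN iffD1, rotated]) (rule local_on_pad[OF assms(2,3)])
qed

lemma local_on_bounded:
  assumes "finite C" "\<infinity> \<in> C" "local_on C n g"
  obtains B where "B > 0" "\<And>\<eta>. \<eta> \<in> space (config_space C) \<Longrightarrow> \<bar>g \<eta>\<bar> \<le> B"
proof -
  \<comment> \<open>Each value of \<open>g\<close> is its value at one of finitely many patterns and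
    is dominated by the sum; the 1 makes the bound strictly positive.\<close>
  define B where "B = 1 + (\<Sum>p\<in>pad n ` space (config_space C). \<bar>g p\<bar>)"
  have "\<bar>g \<eta>\<bar> \<le> B" if "\<eta> \<in> space (config_space C)" for \<eta>
  proof -
    have "\<bar>g (pad n \<eta>)\<bar> \<le> (\<Sum>p\<in>pad n ` space (config_space C). \<bar>g p\<bar>)"
      by (rule member_le_sum) (use that finite_pad_image assms in auto)
    then show ?thesis using local_on_pad[OF assms(2,3) that] by (simp add: B_def)
  qed
  moreover have "B > 0" unfolding B_def by (intro add_pos_nonneg sum_nonneg) auto
  ultimately show ?thesis using that by blast
qed

section \<open>Action of the moves and of the generator on local functions\<close>

lemma exchange_in_space:
  "\<eta> \<in> space (config_space C) \<Longrightarrow> x \<ge> 1 \<Longrightarrow> exchange x \<eta> \<in> space (config_space C)"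
  by (auto simp: space_config exchange_def PiE_def Pi_def extensional_def)

lemma inject_in_space:
  "1 \<in> C \<Longrightarrow> \<eta> \<in> space (config_space C) \<Longrightarrow> inject \<eta> \<in> space (config_space C)"
  by (auto simp: space_config inject_def PiE_def Pi_def extensional_def)

text \<open>A swap across a bond to the right of \<open>n\<close> does not touch the window, so only
  the first \<open>n\<close> bonds survive in the infinite sum.\<close>

lemma generator_local_on:
  assumes g: "local_on C n g" and \<eta>: "\<eta> \<in> space (config_space C)"
  shows "tasep_generator \<alpha> g \<eta> =
     \<alpha> * (g (inject \<eta>) - g \<eta>) + (\<Sum>x\<in>{1..n}. (g (exchange x \<eta>) - g \<eta>))"
proof -
  have "(\<Sum>\<^sub>\<infinity>x\<in>{1..}. (g (exchange x \<eta>) - g \<eta>)) = (\<Sum>\<^sub>\<infinity>x\<in>{1..n}. (g (exchange x \<eta>) - g \<eta>))"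
  proof (rule infsum_cong_neutral)
    fix x assume "x \<in> {1..} - {1..n}"
    then have x: "x \<ge> 1" "x > n" by auto
    have "g (exchange x \<eta>) = g \<eta>"
      by (rule local_onD[OF g exchange_in_space[OF \<eta> x(1)] \<eta>]) (use x(2) in \<open>simp add: exchange_def\<close>)
    then show "g (exchange x \<eta>) - g \<eta> = 0" by simp
  qed auto
  then show ?thesis by (simp add: tasep_generator_def)
qed

lemma local_on_inject:
  assumes "1 \<in> C" and g: "local_on C n g" and "n \<ge> 1"
  shows "local_on C n (\<lambda>\<eta>. g (inject \<eta>))"
proof (rule local_onI)
  fix \<eta> \<xi> assume sp: "\<eta> \<in> space (config_space C)" "\<xi> \<in> space (config_space C)"
    and eq: "\<And>x. 1 \<le> x \<Longrightarrow> x \<le> n \<Longrightarrow> \<eta> x = \<xi> x"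
  have "inject \<eta> x = inject \<xi> x" if "1 \<le> x" "x \<le> n" for x
    using eq[of x] eq[of 1] that \<open>n \<ge> 1\<close> unfolding inject_def by simp
  then show "g (inject \<eta>) = g (inject \<xi>)"
    by (rule local_onD[OF g inject_in_space[OF assms(1) sp(1)] inject_in_space[OF assms(1) sp(2)]])
qed

lemma local_on_exchange:
  assumes g: "local_on C n g" and "x \<ge> 1" "x \<le> n"
  shows "local_on C (Suc n) (\<lambda>\<eta>. g (exchange x \<eta>))"
proof (rule local_onI)
  fix \<eta> \<xi> assume sp: "\<eta> \<in> space (config_space C)" "\<xi> \<in> space (config_space C)"
    and eq: "\<And>x. 1 \<le> x \<Longrightarrow> x \<le> Suc n \<Longrightarrow> \<eta> x = \<xi> x"
  have "exchange x \<eta> y = exchange x \<xi> y" if "1 \<le> y" "y \<le> n" for y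
    using eq[of x] eq[of "x + 1"] eq[of y] that \<open>x \<ge> 1\<close> \<open>x \<le> n\<close> unfolding exchange_def by simp
  then show "g (exchange x \<eta>) = g (exchange x \<xi>)"
    by (rule local_onD[OF g exchange_in_space[OF sp(1) assms(2)] exchange_in_space[OF sp(2) assms(2)]])
qed

text \<open>The swap across the bond \<open>(n, n + 1)\<close> reads site \<open>n + 1\<close>; this
  accounts for the one extra site.\<close>

lemma local_on_generator:
  assumes "1 \<in> C" and g: "local_on C n g" and "n \<ge> 1"
  shows "local_on C (Suc n) (tasep_generator \<alpha> g)"
proof (rule local_onI)
  fix \<eta> \<xi> assume sp: "\<eta> \<in> space (config_space C)" "\<xi> \<in> space (config_space C)"
    and eq: "\<And>x. 1 \<le> x \<Longrightarrow> x \<le> Suc n \<Longrightarrow> \<eta> x = \<xi> x"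
  have "g \<eta> = g \<xi>"
    by (rule local_onD[OF local_on_mono[OF g, of "Suc n"] sp eq]) simp_all
  moreover have "g (inject \<eta>) = g (inject \<xi>)"
    by (rule local_onD[OF local_on_mono[OF local_on_inject[OF assms], of "Suc n"] sp eq]) simp_all
  moreover have "g (exchange x \<eta>) = g (exchange x \<xi>)" if "x \<in> {1..n}" for x
    by (rule local_onD[OF local_on_exchange[OF g] sp eq]) (use that in simp_all)
  ultimately show "tasep_generator \<alpha> g \<eta> = tasep_generator \<alpha> g \<xi>"
    by (simp add: generator_local_on[OF g] sp)
qed

section \<open>The semigroup on local functions\<close>

text \<open>Only the transition semigroup enters here, without paths: the duality concerns
  expectations at a single time.\<close>

locale tasep_semigroup =
  fixes C :: "enat set" and \<alpha> :: real and P :: "real \<Rightarrow> config \<Rightarrow> config measure"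
  assumes finite_C: "finite C" and one_C: "1 \<in> C" and inf_C: "\<infinity> \<in> C"
    and semigroup: "markov_semigroup (config_space C) P"
    and generator: "local_function C g \<Longrightarrow>
      uniform_limit (space (config_space C))
        (\<lambda>h \<eta>. ((\<integral>\<xi>. g \<xi> \<partial>P h \<eta>) - g \<eta>) / h) (tasep_generator \<alpha> g) (at_right 0)"
begin

abbreviation S where "S \<equiv> config_space C"
abbreviation L where "L \<equiv> tasep_generator \<alpha>"

definition T :: "real \<Rightarrow> (config \<Rightarrow> real) \<Rightarrow> config \<Rightarrow> real" where
  "T t g \<eta> = (\<integral>\<xi>. g \<xi> \<partial>P t \<eta>)"

lemma kernel_measurable: "t \<ge> 0 \<Longrightarrow> P t \<in> measurable S (prob_algebra S)"
  using semigroup by (simp add: markov_semigroup_def)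

lemma
  assumes "t \<ge> 0" "\<eta> \<in> space S"
  shows prob_space_P: "prob_space (P t \<eta>)" and sets_P [simp]: "sets (P t \<eta>) = sets S"
  using measurable_space[OF kernel_measurable[OF assms(1)] assms(2)]
  by (auto simp: space_prob_algebra)

lemma space_P [simp]: "t \<ge> 0 \<Longrightarrow> \<eta> \<in> space S \<Longrightarrow> space (P t \<eta>) = space S"
  by (rule sets_eq_imp_space_eq) simp

lemma integrable_bounded:
  fixes g :: "config \<Rightarrow> real"
  assumes "t \<ge> 0" "\<eta> \<in> space S" "g \<in> borel_measurable S"
    and "\<And>\<xi>. \<xi> \<in> space S \<Longrightarrow> \<bar>g \<xi>\<bar> \<le> B"
  shows "integrable (P t \<eta>) g"
proof -
  interpret prob_space "P t \<eta>" by (rule prob_space_P) fact+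
  show ?thesis
  proof (rule integrable_const_bound[where B = B])
    show "AE x in P t \<eta>. norm (g x) \<le> B"
      using assms by (intro AE_I2) simp
    show "g \<in> borel_measurable (P t \<eta>)"
      using assms by (simp add: measurable_cong_sets[OF sets_P refl])
  qed
qed

lemma integrable_local:
  assumes "t \<ge> 0" "\<eta> \<in> space S" "local_on C n g"
  shows "integrable (P t \<eta>) g"
  using local_on_bounded[OF finite_C inf_C assms(3)]
    integrable_bounded[OF assms(1,2) local_on_measurable[OF finite_C inf_C assms(3)]] by metis

lemma T_mono:
  assumes "t \<ge> 0" "\<eta> \<in> space S" "integrable (P t \<eta>) f" "integrable (P t \<eta>) g"
    and "\<And>\<xi>. \<xi> \<in> space S \<Longrightarrow> f \<xi> \<le> g \<xi>"
  shows "T t f \<eta> \<le> T t g \<eta>"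
  unfolding T_def by (rule integral_mono) (use assms in auto)

lemma T_const [simp]: "t \<ge> 0 \<Longrightarrow> \<eta> \<in> space S \<Longrightarrow> T t (\<lambda>_. c) \<eta> = c"
  using prob_space.prob_space[OF prob_space_P[of t \<eta>]] by (simp add: T_def)

lemma T_cong:
  assumes "t \<ge> 0" "\<eta> \<in> space S" "\<And>\<xi>. \<xi> \<in> space S \<Longrightarrow> f \<xi> = g \<xi>"
  shows "T t f \<eta> = T t g \<eta>"
  unfolding T_def by (rule Bochner_Integration.integral_cong) (use assms in auto)

lemma T_abs_le:
  assumes "t \<ge> 0" "\<eta> \<in> space S" "integrable (P t \<eta>) g"
    and "\<And>\<xi>. \<xi> \<in> space S \<Longrightarrow> \<bar>g \<xi>\<bar> \<le> B"
  shows "\<bar>T t g \<eta>\<bar> \<le> B"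
proof -
  interpret prob_space "P t \<eta>" by (rule prob_space_P) fact+
  have "\<bar>T t g \<eta>\<bar> \<le> T t (\<lambda>\<xi>. \<bar>g \<xi>\<bar>) \<eta>"
    unfolding T_def by (rule integral_abs_bound)
  also have "\<dots> \<le> T t (\<lambda>_. B) \<eta>"
    by (rule T_mono) (use assms in auto)
  finally show ?thesis using assms by simp
qed

lemma T_measurable:
  assumes "t \<ge> 0" "g \<in> borel_measurable S"
  shows "T t g \<in> borel_measurable S"
  unfolding T_def
  by (rule measurable_compose[OF measurable_prob_algebraD[OF kernel_measurable[OF assms(1)]]
        integral_measurable_subprob_algebra[OF assms(2)]])

section \<open>Chapman-Kolmogorov and the forward equation\<close>

lemma T_add:
  assumes "s \<ge> 0" "t \<ge> 0" "\<eta> \<in> space S" "local_on C n g"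
  shows "T (s + t) g \<eta> = T s (T t g) \<eta>"
proof -
  obtain B where B: "\<And>\<xi>. \<xi> \<in> space S \<Longrightarrow> \<bar>g \<xi>\<bar> \<le> B"
    using local_on_bounded[OF finite_C inf_C assms(4)] by metis
  interpret prob_space "P s \<eta>" by (rule prob_space_P) fact+
  have "P (s + t) \<eta> = bind (P s \<eta>) (P t)"
    using semigroup assms by (simp add: markov_semigroup_def)
  moreover have "(\<integral>\<xi>. g \<xi> \<partial>bind (P s \<eta>) (P t)) = (\<integral>\<xi>. (\<integral>x. g x \<partial>P t \<xi>) \<partial>P s \<eta>)"
  proof (rule integral_bind[where K = S and B = B and B' = 1])
    show "g \<in> borel_measurable S" by (rule local_on_measurable[OF finite_C inf_C assms(4)])
    show "P t \<in> measurable (P s \<eta>) (subprob_algebra S)"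
      using measurable_prob_algebraD[OF kernel_measurable[OF assms(2)]] assms
      by (simp add: measurable_cong_sets[OF sets_P refl])
    show "finite_measure (P s \<eta>)" by unfold_locales
    show "AE x in P s \<eta>. emeasure (P t x) (space (P t x)) \<le> ennreal 1"
      using assms prob_space.emeasure_space_1[OF prob_space_P[OF assms(2)]] by (intro AE_I2) simp
  qed (rule B)
  ultimately show ?thesis by (simp add: T_def)
qed

lemma T_0:
  assumes "\<eta> \<in> space S" "local_on C n g"
  shows "T 0 g \<eta> = g \<eta>"
  using semigroup assms local_on_measurable[OF finite_C inf_C assms(2)]
  by (simp add: markov_semigroup_def T_def integral_return)

text \<open>One of the two extra sites makes the range positive, as
  \<open>local_on_generator\<close> requires; the other is the site read by the last bond.\<close>

lemma local_L:
  assumes "local_on C n g"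
  shows "local_on C (Suc (Suc n)) (L g)"
  by (rule local_on_generator[OF one_C local_on_mono[OF assms]]) simp_all

text \<open>The generator limit at time 0 is uniform over configurations. Writing
  \<open>T (s + h) g\<close> as \<open>T s (T h g)\<close> and averaging the estimate over
  \<open>P s \<eta>\<close> carries it to time \<open>s\<close>, with the same \<open>d\<close> for
  all \<open>s\<close>.\<close>

lemma T_increment:
  assumes g: "local_on C n g" and "e > 0"
  obtains d where "d > 0"
    "\<And>s h \<eta>. s \<ge> 0 \<Longrightarrow> 0 < h \<Longrightarrow> h < d \<Longrightarrow> \<eta> \<in> space S \<Longrightarrow>
       \<bar>T (s + h) g \<eta> - T s g \<eta> - h * T s (L g) \<eta>\<bar> \<le> e * h"
proof -
  have "\<forall>\<^sub>F h in at_right 0. \<forall>\<eta>\<in>space S. dist (((\<integral>\<xi>. g \<xi> \<partial>P h \<eta>) - g \<eta>) / h) (L g \<eta>) < e"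
    using generator[OF local_on_imp_local[OF g]] \<open>e > 0\<close> unfolding uniform_limit_iff by blast
  then obtain d where d: "d > 0" and
    "\<forall>h>0. h < d \<longrightarrow> (\<forall>\<eta>\<in>space S. dist ((T h g \<eta> - g \<eta>) / h) (L g \<eta>) < e)"
    unfolding eventually_at_right_field T_def by auto
  then have close: "\<bar>T h g \<eta> - g \<eta> - h * L g \<eta>\<bar> \<le> e * h"
    if "0 < h" "h < d" "\<eta> \<in> space S" for h \<eta>
  proof -
    have "\<bar>(T h g \<eta> - g \<eta>) / h - L g \<eta>\<bar> < e"
      using \<open>\<forall>h>0. _\<close> that by (auto simp: dist_real_def)
    moreover have "T h g \<eta> - g \<eta> - h * L g \<eta> = h * ((T h g \<eta> - g \<eta>) / h - L g \<eta>)"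
      using that by (simp add: field_simps)
    ultimately show ?thesis
      using that by (simp add: abs_mult mult.commute)
  qed
  obtain B where B: "\<And>\<xi>. \<xi> \<in> space S \<Longrightarrow> \<bar>g \<xi>\<bar> \<le> B"
    using local_on_bounded[OF finite_C inf_C g] by metis
  have "\<bar>T (s + h) g \<eta> - T s g \<eta> - h * T s (L g) \<eta>\<bar> \<le> e * h"
    if that: "s \<ge> 0" "0 < h" "h < d" "\<eta> \<in> space S" for s h \<eta>
  proof -
    have i1: "integrable (P s \<eta>) (T h g)"
    proof (rule integrable_bounded)
      show "T h g \<in> borel_measurable S"
        by (rule T_measurable) (use that local_on_measurable[OF finite_C inf_C g] in auto)
      show "\<bar>T h g \<xi>\<bar> \<le> B" if "\<xi> \<in> space S" for \<xi>
        by (rule T_abs_le) (use that \<open>0 < h\<close> B integrable_local[OF _ _ g] in auto)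
    qed (use that in auto)
    have i2: "integrable (P s \<eta>) g" by (rule integrable_local[OF _ _ g]) (use that in auto)
    have i3: "integrable (P s \<eta>) (L g)" by (rule integrable_local[OF _ _ local_L[OF g]]) (use that in auto)
    have "T (s + h) g \<eta> - T s g \<eta> - h * T s (L g) \<eta> = T s (\<lambda>\<xi>. T h g \<xi> - g \<xi> - h * L g \<xi>) \<eta>"
      using T_add[OF _ _ _ g, of s h \<eta>] that i1 i2 i3 by (simp add: T_def[of s])
    also have "\<bar>\<dots>\<bar> \<le> e * h"
      by (rule T_abs_le) (use that close i1 i2 i3 in auto)
    finally show ?thesis .
  qed
  then show ?thesis using that d by blast
qed

text \<open>The increment estimate combined with boundedness of \<open>L g\<close>. Applied to
  \<open>L g\<close>, which is again local, it gives the continuity in time needed for left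
  derivatives.\<close>

lemma T_lipschitz:
  assumes g: "local_on C n g"
  obtains d K where "d > 0" "K > 0"
    "\<And>s h \<eta>. s \<ge> 0 \<Longrightarrow> 0 < h \<Longrightarrow> h < d \<Longrightarrow> \<eta> \<in> space S \<Longrightarrow>
       \<bar>T (s + h) g \<eta> - T s g \<eta>\<bar> \<le> K * h"
proof -
  obtain d where d: "d > 0" "\<And>s h \<eta>. s \<ge> 0 \<Longrightarrow> 0 < h \<Longrightarrow> h < d \<Longrightarrow> \<eta> \<in> space S \<Longrightarrow>
       \<bar>T (s + h) g \<eta> - T s g \<eta> - h * T s (L g) \<eta>\<bar> \<le> 1 * h"
    using T_increment[OF g, of 1] by auto
  obtain B where B: "B > 0" "\<And>\<xi>. \<xi> \<in> space S \<Longrightarrow> \<bar>L g \<xi>\<bar> \<le> B"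
    using local_on_bounded[OF finite_C inf_C local_L[OF g]] by metis
  have "\<bar>T (s + h) g \<eta> - T s g \<eta>\<bar> \<le> (1 + B) * h"
    if that: "s \<ge> 0" "0 < h" "h < d" "\<eta> \<in> space S" for s h \<eta>
  proof -
    have "\<bar>T s (L g) \<eta>\<bar> \<le> B"
      by (rule T_abs_le) (use that B integrable_local[OF _ _ local_L[OF g]] in auto)
    then have "\<bar>h * T s (L g) \<eta>\<bar> \<le> B * h"
      using that by (simp add: abs_mult mult.commute)
    then show ?thesis using d(2)[OF that] by (simp add: algebra_simps)
  qed
  then show ?thesis using that[of d "1 + B"] d(1) B(1) by auto
qed

text \<open>The Kolmogorov forward equation. \<open>T_increment\<close> yields the derivative from
  the right at once. From the left it produces the expectation of \<open>L g\<close> at the earlier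
  time, which \<open>T_lipschitz\<close> moves to time \<open>t\<close>.\<close>

lemma T_has_derivative:
  assumes g: "local_on C n g" and "t \<ge> 0" "\<eta> \<in> space S"
  shows "((\<lambda>s. T s g \<eta>) has_real_derivative T t (L g) \<eta>) (at t within {0..})"
  unfolding has_field_derivative_def has_derivative_within_alt
proof (intro conjI allI impI)
  fix e :: real assume "e > 0"
  obtain d where d: "d > 0" "\<And>s h \<eta>. s \<ge> 0 \<Longrightarrow> 0 < h \<Longrightarrow> h < d \<Longrightarrow> \<eta> \<in> space S \<Longrightarrow>
       \<bar>T (s + h) g \<eta> - T s g \<eta> - h * T s (L g) \<eta>\<bar> \<le> e / 2 * h"
    using T_increment[OF g, of "e / 2"] \<open>e > 0\<close> by auto
  obtain d' K where K: "d' > 0" "K > 0" "\<And>s h \<eta>. s \<ge> 0 \<Longrightarrow> 0 < h \<Longrightarrow> h < d' \<Longrightarrow> \<eta> \<in> space S \<Longrightarrow>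
       \<bar>T (s + h) (L g) \<eta> - T s (L g) \<eta>\<bar> \<le> K * h"
    using T_lipschitz[OF local_L[OF g]] by metis
  \<comment> \<open>The third entry makes the Lipschitz error \<open>K * h\<close> at most
    \<open>e / 2\<close>; the increment estimate uses the other half of \<open>e\<close>.\<close>
  define r where "r = Min {d, d', e / (2 * K)}"
  have r: "r > 0" "r \<le> d" "r \<le> d'" "r \<le> e / (2 * K)"
    using d K \<open>e > 0\<close> by (auto simp: r_def)
  have "norm (T y g \<eta> - T t g \<eta> - T t (L g) \<eta> * (y - t)) \<le> e * norm (y - t)"
    if y: "y \<in> {0..}" "norm (y - t) < r" for y
  proof -
    consider "y = t" | "y > t" | "y < t" by linarith
    then show ?thesis
    proof cases
      case 2
      have "\<bar>T (t + (y - t)) g \<eta> - T t g \<eta> - (y - t) * T t (L g) \<eta>\<bar> \<le> e / 2 * (y - t)"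
        by (rule d(2)) (use 2 y r assms in auto)
      also have "\<dots> \<le> e * (y - t)" using 2 \<open>e > 0\<close> by (intro mult_right_mono) auto
      finally show ?thesis using 2 by (simp add: mult.commute)
    next
      case 3
      \<comment> \<open>From the left the increment starts at \<open>y\<close>, not at
        \<open>t\<close>.\<close>
      define h where "h = t - y"
      have h: "0 < h" "h < r" using 3 y by (auto simp: h_def)
      have 1: "\<bar>T (y + h) g \<eta> - T y g \<eta> - h * T y (L g) \<eta>\<bar> \<le> e / 2 * h"
        by (rule d(2)) (use h y r assms in auto)
      have "\<bar>T (y + h) (L g) \<eta> - T y (L g) \<eta>\<bar> \<le> K * h"
        by (rule K(3)) (use h y r assms in auto)
      also have "\<dots> \<le> K * (e / (2 * K))" using h r K by (intro mult_left_mono) auto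
      also have "\<dots> = e / 2" using K by simp
      finally have "\<bar>h * (T (y + h) (L g) \<eta> - T y (L g) \<eta>)\<bar> \<le> e / 2 * h"
        using h by (simp add: abs_mult mult.commute)
      moreover have "\<bar>a - c\<bar> \<le> \<bar>a - b\<bar> + \<bar>c - b\<bar>" for a b c :: real by linarith
      ultimately have "\<bar>T (y + h) g \<eta> - T y g \<eta> - h * T (y + h) (L g) \<eta>\<bar> \<le> e / 2 * h + e / 2 * h"
        using 1 unfolding right_diff_distrib by (meson add_mono order.trans)
      then have "\<bar>T (y + h) g \<eta> - T y g \<eta> - h * T (y + h) (L g) \<eta>\<bar> \<le> e * h"
        by (simp add: field_simps)
      then have "\<bar>T t g \<eta> - T y g \<eta> - (t - y) * T t (L g) \<eta>\<bar> \<le> e * (t - y)"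
        by (simp add: h_def)
      moreover have "T y g \<eta> - T t g \<eta> - T t (L g) \<eta> * (y - t) = - (T t g \<eta> - T y g \<eta> - (t - y) * T t (L g) \<eta>)"
        by (simp add: algebra_simps)
      ultimately show ?thesis using 3 by simp
    qed auto
  qed
  then show "\<exists>d>0. \<forall>y\<in>{0..}. norm (y - t) < d \<longrightarrow>
      norm (T y g \<eta> - T t g \<eta> - T t (L g) \<eta> * (y - t)) \<le> e * norm (y - t)"
    using r(1) by blast
qed (rule bounded_linear_mult_right)

end

section \<open>Linearity and expansion into pattern indicators\<close>

lemma generator_cong:
  assumes "1 \<in> C" "\<eta> \<in> space (config_space C)"
    and "\<And>\<xi>. \<xi> \<in> space (config_space C) \<Longrightarrow> f \<xi> = g \<xi>"
  shows "tasep_generator \<alpha> f \<eta> = tasep_generator \<alpha> g \<eta>"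
proof -
  have "(\<Sum>\<^sub>\<infinity>x\<in>{1..}. f (exchange x \<eta>) - f \<eta>) = (\<Sum>\<^sub>\<infinity>x\<in>{1..}. g (exchange x \<eta>) - g \<eta>)"
    by (rule infsum_cong) (simp only: assms exchange_in_space atLeast_iff)
  then show ?thesis
    unfolding tasep_generator_def by (simp only: assms inject_in_space)
qed

lemma local_on_sum:
  assumes "\<And>q. q \<in> Q \<Longrightarrow> local_on C n (f q)"
  shows "local_on C n (\<lambda>\<xi>. \<Sum>q\<in>Q. c q * f q \<xi>)"
proof (rule local_onI)
  fix \<eta> \<xi> assume sp: "\<eta> \<in> space (config_space C)" "\<xi> \<in> space (config_space C)"
    and eq: "\<And>x. 1 \<le> x \<Longrightarrow> x \<le> n \<Longrightarrow> \<eta> x = \<xi> x"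
  have "f q \<eta> = f q \<xi>" if "q \<in> Q" for q
    by (rule local_onD[OF assms[OF that] sp eq])
  then show "(\<Sum>q\<in>Q. c q * f q \<eta>) = (\<Sum>q\<in>Q. c q * f q \<xi>)" by simp
qed

lemma generator_sum:
  assumes "\<eta> \<in> space (config_space C)" and f: "\<And>q. q \<in> Q \<Longrightarrow> local_on C n (f q)"
  shows "tasep_generator \<alpha> (\<lambda>\<xi>. \<Sum>q\<in>Q. c q * f q \<xi>) \<eta> = (\<Sum>q\<in>Q. c q * tasep_generator \<alpha> (f q) \<eta>)"
proof -
  have diff: "(\<Sum>q\<in>Q. c q * f q \<xi>) - (\<Sum>q\<in>Q. c q * f q \<eta>) = (\<Sum>q\<in>Q. c q * (f q \<xi> - f q \<eta>))" for \<xi>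
    by (simp add: sum_subtractf right_diff_distrib)
  have loc: "local_on C n (\<lambda>\<xi>. \<Sum>q\<in>Q. c q * f q \<xi>)" by (rule local_on_sum) (rule f)
  have "tasep_generator \<alpha> (\<lambda>\<xi>. \<Sum>q\<in>Q. c q * f q \<xi>) \<eta> =
      \<alpha> * (\<Sum>q\<in>Q. c q * (f q (inject \<eta>) - f q \<eta>)) +
      (\<Sum>q\<in>Q. \<Sum>x\<in>{1..n}. c q * (f q (exchange x \<eta>) - f q \<eta>))"
    unfolding generator_local_on[OF loc assms(1)] diff by (subst sum.swap) (rule refl)
  also have "\<dots> = (\<Sum>q\<in>Q. c q * (\<alpha> * (f q (inject \<eta>) - f q \<eta>) +
      (\<Sum>x\<in>{1..n}. f q (exchange x \<eta>) - f q \<eta>)))"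
    unfolding distrib_left sum.distrib sum_distrib_left by (simp only: mult.left_commute)
  also have "\<dots> = (\<Sum>q\<in>Q. c q * tasep_generator \<alpha> (f q) \<eta>)"
    by (intro sum.cong refl) (simp only: generator_local_on[OF f assms(1)])
  finally show ?thesis .
qed

text \<open>The indicators of patterns span the functions of range \<open>n\<close>. Functions of
  two configurations are expanded in them, so that the variables separate into finite sums of
  products.\<close>

definition cylinder :: "nat \<Rightarrow> config \<Rightarrow> config \<Rightarrow> real" where
  "cylinder n q \<eta> = of_bool (pad n \<eta> = q)"

lemma local_on_cylinder: "local_on C n (cylinder n q)"
proof (rule local_onI)
  fix \<eta> \<xi> :: config
  assume eq: "\<And>x. 1 \<le> x \<Longrightarrow> x \<le> n \<Longrightarrow> \<eta> x = \<xi> x"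
  have "pad n \<eta> = pad n \<xi>"
    unfolding pad_eq_iff
  proof
    fix x assume "x \<in> {1..n}"
    then show "\<eta> x = \<xi> x" using eq[of x] by simp
  qed
  then show "cylinder n q \<eta> = cylinder n q \<xi>" by (simp add: cylinder_def)
qed

lemma local_on_expansion:
  assumes "finite C" "\<infinity> \<in> C" "local_on C n f" "\<eta> \<in> space (config_space C)"
  shows "f \<eta> = (\<Sum>q\<in>pad n ` space (config_space C). f q * cylinder n q \<eta>)"
proof -
  have "(\<Sum>q\<in>pad n ` space (config_space C). f q * cylinder n q \<eta>) =
      (\<Sum>q\<in>pad n ` space (config_space C). if pad n \<eta> = q then f q else 0)"
    by (intro sum.cong) (auto simp: cylinder_def)
  also have "\<dots> = f (pad n \<eta>)"
    using assms(4) finite_pad_image[OF assms(1)] by simp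
  finally show ?thesis using local_on_pad[OF assms(2-4)] by simp
qed

context tasep_semigroup begin

lemma T_sum:
  assumes "t \<ge> 0" "\<eta> \<in> space S" "\<And>q. q \<in> Q \<Longrightarrow> local_on C n (f q)"
  shows "T t (\<lambda>\<xi>. \<Sum>q\<in>Q. c q * f q \<xi>) \<eta> = (\<Sum>q\<in>Q. c q * T t (f q) \<eta>)"
proof -
  have "integrable (P t \<eta>) (\<lambda>\<xi>. c q * f q \<xi>)" if "q \<in> Q" for q
    by (rule integrable_mult_right) (rule integrable_local[OF assms(1,2) assms(3)[OF that]])
  from Bochner_Integration.integral_sum[OF this] show ?thesis
    by (simp only: T_def integral_mult_right_zero)
qed

lemma T_expansion:
  assumes "t \<ge> 0" "\<eta> \<in> space S" "local_on C n f"
  shows "T t f \<eta> = (\<Sum>q\<in>pad n ` space S. f q * T t (cylinder n q) \<eta>)"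
proof -
  have "T t f \<eta> = T t (\<lambda>\<xi>. \<Sum>q\<in>pad n ` space S. f q * cylinder n q \<xi>) \<eta>"
    by (rule T_cong[OF assms(1,2)]) (rule local_on_expansion[OF finite_C inf_C assms(3)])
  also have "\<dots> = (\<Sum>q\<in>pad n ` space S. f q * T t (cylinder n q) \<eta>)"
    by (rule T_sum[OF assms(1,2) local_on_cylinder])
  finally show ?thesis .
qed

text \<open>A comparison principle: \<open>\<psi> s - T s g \<eta>\<close> is nonnegative at 0 and
  has a nonnegative derivative, so it stays nonnegative by the mean value theorem.\<close>

lemma T_upper:
  assumes g: "local_on C n g" and "t \<ge> 0" "\<eta> \<in> space S" "g \<eta> \<le> \<psi> 0"
    and \<psi>: "\<And>s. 0 \<le> s \<Longrightarrow> s \<le> t \<Longrightarrow> (\<psi> has_real_derivative \<psi>' s) (at s within {0..t})"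
    and le: "\<And>s. 0 \<le> s \<Longrightarrow> s \<le> t \<Longrightarrow> T s (L g) \<eta> \<le> \<psi>' s"
  shows "T t g \<eta> \<le> \<psi> t"
proof (cases "t = 0")
  case True
  then show ?thesis using T_0[OF assms(3) g] assms(4) by simp
next
  case False
  then have "0 < t" using assms(2) by simp
  have "((\<lambda>s. \<psi> s - T s g \<eta>) has_derivative (*) (\<psi>' s - T s (L g) \<eta>)) (at s within {0..t})"
    if s: "0 \<le> s" "s \<le> t" for s
  proof -
    have "((\<lambda>s. T s g \<eta>) has_real_derivative T s (L g) \<eta>) (at s within {0..t})"
      by (rule has_field_derivative_subset[OF T_has_derivative[OF g s(1) assms(3)]]) simp
    from DERIV_diff[OF \<psi>[OF s] this] show ?thesis
      by (simp only: has_field_derivative_def)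
  qed
  from mvt_simple[OF \<open>0 < t\<close> this] obtain x where x: "x \<in> {0<..<t}"
    "\<psi> t - T t g \<eta> - (\<psi> 0 - T 0 g \<eta>) = (\<psi>' x - T x (L g) \<eta>) * (t - 0)" by (rule bexE)
  have "0 \<le> (\<psi>' x - T x (L g) \<eta>) * (t - 0)" using le[of x] x(1) by (intro mult_nonneg_nonneg) auto
  then show ?thesis using x(2) T_0[OF assms(3) g] assms(4) by simp
qed

end

section \<open>Finite speed of propagation\<close>

definition occ :: "nat \<Rightarrow> config \<Rightarrow> real" where
  "occ n \<eta> = of_bool (\<eta> n \<noteq> \<infinity>)"

lemma local_on_occ: "1 \<le> n \<Longrightarrow> local_on C n (occ n)"
  by (rule local_onI) (simp add: occ_def)

text \<open>Site \<open>m + 1\<close> can be filled only by a jump from \<open>m\<close>, at rate 1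
  and only if \<open>m\<close> is occupied. Every other move leaves its occupation unchanged or
  empties it.\<close>

lemma generator_occ_le:
  assumes \<eta>: "\<eta> \<in> space (config_space C)" and m: "1 \<le> m"
  shows "tasep_generator \<alpha> (occ (Suc m)) \<eta> \<le> occ m \<eta>"
proof -
  have inj: "occ (Suc m) (inject \<eta>) = occ (Suc m) \<eta>"
    using m by (simp add: occ_def inject_def)
  have "occ (Suc m) (exchange x \<eta>) - occ (Suc m) \<eta> \<le> (if x = m then occ m \<eta> else 0)" for x
  proof (cases "\<eta> x < \<eta> (x + 1)")
    case True
    \<comment> \<open>A content strictly below another one is finite, so only particles move to the
      right.\<close>
    have "\<eta> x \<noteq> \<infinity>"
    proof
      assume "\<eta> x = \<infinity>"
      with True show False by simp
    qed
    with True show ?thesis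
      by (simp add: occ_def exchange_def)
  next
    case False
    then show ?thesis by (simp add: exchange_def occ_def)
  qed
  then have "(\<Sum>x\<in>{1..Suc m}. occ (Suc m) (exchange x \<eta>) - occ (Suc m) \<eta>)
      \<le> (\<Sum>x\<in>{1..Suc m}. if x = m then occ m \<eta> else 0)"
    by (intro sum_mono)
  also have "\<dots> = occ m \<eta>"
    using m by (subst sum.delta) auto
  finally show ?thesis
    by (subst generator_local_on[OF local_on_occ \<eta>]) (use inj in simp_all)
qed

context tasep_semigroup begin

text \<open>A site at distance \<open>k\<close> from the initial particles is reached only through
  the \<open>k\<close> bonds in between. Each of them costs one integration of the generator bound,
  which turns \<open>s ^ k / fact k\<close> into \<open>s ^ Suc k / fact (Suc k)\<close>.\<close>

lemma T_occ_le:
  assumes u: "u \<in> space S" "\<And>x. x > l \<Longrightarrow> u x = \<infinity>" and "1 \<le> l" "0 \<le> s"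
  shows "T s (occ (l + k)) u \<le> s ^ k / fact k"
  using \<open>0 \<le> s\<close>
proof (induction k arbitrary: s)
  case 0
  have "\<bar>T s (occ l) u\<bar> \<le> 1"
    by (rule T_abs_le[OF 0 u(1) integrable_local[OF 0 u(1) local_on_occ[OF \<open>1 \<le> l\<close>]]]) (simp add: occ_def)
  then show ?case by simp
next
  case (Suc k)
  show ?case
  proof (rule T_upper[where \<psi>' = "\<lambda>s. s ^ k / fact k"])
    show "local_on C (l + Suc k) (occ (l + Suc k))" by (rule local_on_occ) simp
    show "occ (l + Suc k) u \<le> 0 ^ Suc k / fact (Suc k)" using u(2) by (simp add: occ_def)
    fix r assume r: "0 \<le> r" "r \<le> s"
    show "((\<lambda>s. s ^ Suc k / fact (Suc k)) has_real_derivative r ^ k / fact k) (at r within {0..s})"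
      using DERIV_cdivide[OF DERIV_power[where n = "Suc k", OF DERIV_ident, of r "{0..s}"], of "fact (Suc k)"]
      by (simp add: divide_simps del: of_nat_Suc)
    have "T r (L (occ (l + Suc k))) u \<le> T r (occ (l + k)) u"
    proof (rule T_mono)
      show "integrable (P r u) (L (occ (l + Suc k)))"
        by (rule integrable_local[OF r(1) u(1) local_L[OF local_on_occ]]) simp
      show "integrable (P r u) (occ (l + k))"
        by (rule integrable_local[OF r(1) u(1) local_on_occ]) (use \<open>1 \<le> l\<close> in simp)
      show "L (occ (l + Suc k)) \<xi> \<le> occ (l + k) \<xi>" if "\<xi> \<in> space S" for \<xi>
        using generator_occ_le[OF that, of "l + k"] \<open>1 \<le> l\<close> by simp
    qed (rule r u)+
    also have "\<dots> \<le> r ^ k / fact k" by (rule Suc.IH) (rule r)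
    finally show "T r (L (occ (l + Suc k))) u \<le> r ^ k / fact k" .
  qed (rule Suc.prems u)+
qed

end

section \<open>Duality of two semigroups\<close>

context tasep_semigroup begin

lemma T_diff:
  assumes "integrable (P t \<eta>) f" "integrable (P t \<eta>) g"
  shows "T t (\<lambda>\<xi>. f \<xi> - g \<xi>) \<eta> = T t f \<eta> - T t g \<eta>"
  unfolding T_def by (rule Bochner_Integration.integral_diff[OF assms])

lemma T_abs_mono:
  assumes t: "t \<ge> 0" "\<eta> \<in> space S" and f: "integrable (P t \<eta>) f" and g: "integrable (P t \<eta>) g"
    and le: "\<And>\<xi>. \<xi> \<in> space S \<Longrightarrow> \<bar>f \<xi>\<bar> \<le> g \<xi>"
  shows "\<bar>T t f \<eta>\<bar> \<le> T t g \<eta>"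
proof -
  have "\<bar>T t f \<eta>\<bar> \<le> T t (\<lambda>\<xi>. \<bar>f \<xi>\<bar>) \<eta>"
    unfolding T_def by (rule integral_abs_bound)
  also have "\<dots> \<le> T t g \<eta>"
    by (rule T_mono[OF t integrable_abs[OF f] g le])
  finally show ?thesis .
qed

lemma T_reverse_derivative:
  assumes g: "local_on C n g" and "\<eta> \<in> space S" "0 \<le> s" "s \<le> t"
  shows "((\<lambda>s. T (t - s) g \<eta>) has_real_derivative - T (t - s) (L g) \<eta>) (at s within {0..t})"
proof -
  have "((\<lambda>s. T s g \<eta>) has_real_derivative T (t - s) (L g) \<eta>) (at (t - s) within (\<lambda>s. t - s) ` {0..t})"
    by (rule has_field_derivative_subset[OF T_has_derivative[OF g _ assms(2)]]) (use assms(3,4) in auto)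
  moreover have "((\<lambda>s. t - s) has_real_derivative - 1) (at s within {0..t})"
    by (auto intro!: derivative_eq_intros)
  ultimately have "((\<lambda>s. T s g \<eta>) \<circ> (\<lambda>s. t - s) has_real_derivative T (t - s) (L g) \<eta> * - 1) (at s within {0..t})"
    by (rule DERIV_image_chain)
  then show ?thesis by (simp add: o_def)
qed

end

section \<open>Interpolation between two semigroups\<close>

locale tasep_pair =
  A: tasep_semigroup C \<alpha> P + B: tasep_semigroup C' \<alpha> P'
  for C C' \<alpha> P P' +
  fixes D :: "config \<Rightarrow> config \<Rightarrow> real" and n :: nat
  assumes D1: "local_on C' n (D \<eta>)" and D2: "local_on C n (\<lambda>\<eta>. D \<eta> \<zeta>)"
begin

text \<open>The defect of generator duality: if it vanished, the two expectations of
  \<open>D\<close> would agree exactly.\<close>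

definition discrepancy :: "config \<Rightarrow> config \<Rightarrow> real" where
  "discrepancy \<eta> \<zeta> = B.L (D \<eta>) \<zeta> - A.L (\<lambda>\<xi>. D \<xi> \<zeta>) \<eta>"

abbreviation patterns where "patterns \<equiv> pad n ` space B.S"

lemma expansion:
  assumes "\<zeta> \<in> space B.S"
  shows "D \<eta> \<zeta> = (\<Sum>q\<in>patterns. D \<eta> q * cylinder n q \<zeta>)"
  by (rule local_on_expansion[OF B.finite_C B.inf_C D1 assms])

text \<open>Expanding \<open>D\<close> in the patterns of its second argument gives a finite sum of
  products of a function of \<open>\<eta>\<close> and a function of \<open>\<zeta>\<close>.
  Integrability and iterated expectations then reduce to local functions of a single
  variable.\<close>

lemma discrepancy_expansion:
  assumes "\<eta> \<in> space A.S" "\<zeta> \<in> space B.S"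
  shows "discrepancy \<eta> \<zeta> = (\<Sum>q\<in>patterns. D \<eta> q * B.L (cylinder n q) \<zeta>)
    - (\<Sum>q\<in>patterns. A.L (\<lambda>\<xi>. D \<xi> q) \<eta> * cylinder n q \<zeta>)"
proof -
  have "B.L (D \<eta>) \<zeta> = B.L (\<lambda>\<zeta>. \<Sum>q\<in>patterns. D \<eta> q * cylinder n q \<zeta>) \<zeta>"
    by (rule generator_cong[OF B.one_C assms(2)]) (rule expansion)
  also have "\<dots> = (\<Sum>q\<in>patterns. D \<eta> q * B.L (cylinder n q) \<zeta>)"
    by (rule generator_sum[OF assms(2) local_on_cylinder])
  finally have 1: "B.L (D \<eta>) \<zeta> = (\<Sum>q\<in>patterns. D \<eta> q * B.L (cylinder n q) \<zeta>)" .
  have "A.L (\<lambda>\<xi>. D \<xi> \<zeta>) \<eta> = A.L (\<lambda>\<xi>. \<Sum>q\<in>patterns. cylinder n q \<zeta> * D \<xi> q) \<eta>"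
    by (rule generator_cong[OF A.one_C assms(1)]) (subst expansion[OF assms(2)], simp only: mult.commute)
  also have "\<dots> = (\<Sum>q\<in>patterns. cylinder n q \<zeta> * A.L (\<lambda>\<xi>. D \<xi> q) \<eta>)"
    by (rule generator_sum[OF assms(1) D2])
  finally have 2: "A.L (\<lambda>\<xi>. D \<xi> \<zeta>) \<eta> = (\<Sum>q\<in>patterns. A.L (\<lambda>\<xi>. D \<xi> q) \<eta> * cylinder n q \<zeta>)"
    by (simp only: mult.commute)
  show ?thesis unfolding discrepancy_def 1 2 ..
qed

lemma integrable_discrepancy:
  assumes "s \<ge> 0" "\<eta> \<in> space A.S" "e \<in> space B.S"
  shows "integrable (P' s e) (discrepancy \<eta>)"
    and "B.T s (discrepancy \<eta>) e = (\<Sum>q\<in>patterns. D \<eta> q * B.T s (B.L (cylinder n q)) e)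
      - (\<Sum>q\<in>patterns. A.L (\<lambda>\<xi>. D \<xi> q) \<eta> * B.T s (cylinder n q) e)"
proof -
  let ?f = "\<lambda>\<zeta>. \<Sum>q\<in>patterns. D \<eta> q * B.L (cylinder n q) \<zeta>"
  let ?g = "\<lambda>\<zeta>. \<Sum>q\<in>patterns. A.L (\<lambda>\<xi>. D \<xi> q) \<eta> * cylinder n q \<zeta>"
  have lc: "local_on C' (Suc (Suc n)) (B.L (cylinder n q))" for q
    by (rule B.local_L[OF local_on_cylinder])
  have f: "integrable (P' s e) ?f"
    by (rule B.integrable_local[OF assms(1,3) local_on_sum[OF lc]])
  have g: "integrable (P' s e) ?g"
    by (rule B.integrable_local[OF assms(1,3) local_on_sum[OF local_on_cylinder]])
  have "integrable (P' s e) (\<lambda>\<zeta>. ?f \<zeta> - ?g \<zeta>)"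
    by (rule Bochner_Integration.integrable_diff[OF f g])
  then show "integrable (P' s e) (discrepancy \<eta>)"
    by (rule Bochner_Integration.integrable_cong[THEN iffD2, OF refl, rotated])
      (simp only: B.space_P assms discrepancy_expansion)
  have "B.T s (discrepancy \<eta>) e = B.T s (\<lambda>\<zeta>. ?f \<zeta> - ?g \<zeta>) e"
    by (rule B.T_cong[OF assms(1,3)]) (rule discrepancy_expansion[OF assms(2)])
  also have "\<dots> = B.T s ?f e - B.T s ?g e"
    by (rule B.T_diff[OF f g])
  also have "B.T s ?f e = (\<Sum>q\<in>patterns. D \<eta> q * B.T s (B.L (cylinder n q)) e)"
    by (rule B.T_sum[OF assms(1,3) lc])
  also have "B.T s ?g e = (\<Sum>q\<in>patterns. A.L (\<lambda>\<xi>. D \<xi> q) \<eta> * B.T s (cylinder n q) e)"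
    by (rule B.T_sum[OF assms(1,3) local_on_cylinder])
  finally show "B.T s (discrepancy \<eta>) e = (\<Sum>q\<in>patterns. D \<eta> q * B.T s (B.L (cylinder n q)) e)
      - (\<Sum>q\<in>patterns. A.L (\<lambda>\<xi>. D \<xi> q) \<eta> * B.T s (cylinder n q) e)" .
qed

lemma iterated_discrepancy:
  assumes "r \<ge> 0" "s \<ge> 0" "u \<in> space A.S" "e \<in> space B.S"
  shows "integrable (P r u) (\<lambda>\<eta>. B.T s (discrepancy \<eta>) e)"
    and "A.T r (\<lambda>\<eta>. B.T s (discrepancy \<eta>) e) u =
      (\<Sum>q\<in>patterns. B.T s (B.L (cylinder n q)) e * A.T r (\<lambda>\<eta>. D \<eta> q) u)
      - (\<Sum>q\<in>patterns. B.T s (cylinder n q) e * A.T r (A.L (\<lambda>\<xi>. D \<xi> q)) u)"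
proof -
  let ?f = "\<lambda>\<eta>. \<Sum>q\<in>patterns. B.T s (B.L (cylinder n q)) e * D \<eta> q"
  let ?g = "\<lambda>\<eta>. \<Sum>q\<in>patterns. B.T s (cylinder n q) e * A.L (\<lambda>\<xi>. D \<xi> q) \<eta>"
  have eq: "B.T s (discrepancy \<eta>) e = ?f \<eta> - ?g \<eta>" if "\<eta> \<in> space A.S" for \<eta>
    unfolding integrable_discrepancy(2)[OF assms(2) that assms(4)] by (simp only: mult.commute)
  have lc: "local_on C (Suc (Suc n)) (A.L (\<lambda>\<xi>. D \<xi> q))" for q
    by (rule A.local_L[OF D2])
  have f: "integrable (P r u) ?f"
    by (rule A.integrable_local[OF assms(1,3) local_on_sum[OF D2]])
  have g: "integrable (P r u) ?g"
    by (rule A.integrable_local[OF assms(1,3) local_on_sum[OF lc]])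
  have "integrable (P r u) (\<lambda>\<eta>. ?f \<eta> - ?g \<eta>)"
    by (rule Bochner_Integration.integrable_diff[OF f g])
  then show "integrable (P r u) (\<lambda>\<eta>. B.T s (discrepancy \<eta>) e)"
    by (rule Bochner_Integration.integrable_cong[THEN iffD2, OF refl, rotated])
      (simp only: A.space_P assms eq)
  have "A.T r (\<lambda>\<eta>. B.T s (discrepancy \<eta>) e) u = A.T r (\<lambda>\<eta>. ?f \<eta> - ?g \<eta>) u"
    by (rule A.T_cong[OF assms(1,3)]) (rule eq)
  also have "\<dots> = A.T r ?f u - A.T r ?g u"
    by (rule A.T_diff[OF f g])
  also have "A.T r ?f u = (\<Sum>q\<in>patterns. B.T s (B.L (cylinder n q)) e * A.T r (\<lambda>\<eta>. D \<eta> q) u)"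
    by (rule A.T_sum[OF assms(1,3) D2])
  also have "A.T r ?g u = (\<Sum>q\<in>patterns. B.T s (cylinder n q) e * A.T r (A.L (\<lambda>\<xi>. D \<xi> q)) u)"
    by (rule A.T_sum[OF assms(1,3) lc])
  finally show "A.T r (\<lambda>\<eta>. B.T s (discrepancy \<eta>) e) u =
      (\<Sum>q\<in>patterns. B.T s (B.L (cylinder n q)) e * A.T r (\<lambda>\<eta>. D \<eta> q) u)
      - (\<Sum>q\<in>patterns. B.T s (cylinder n q) e * A.T r (A.L (\<lambda>\<xi>. D \<xi> q)) u)" .
qed

text \<open>In this form each semigroup sits in a factor of its own, so that the product rule
  applies.\<close>

lemma iterated_expansion:
  assumes "r \<ge> 0" "s \<ge> 0" "u \<in> space A.S" "e \<in> space B.S"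
  shows "A.T r (\<lambda>\<eta>. B.T s (D \<eta>) e) u = (\<Sum>q\<in>patterns. B.T s (cylinder n q) e * A.T r (\<lambda>\<eta>. D \<eta> q) u)"
proof -
  have "A.T r (\<lambda>\<eta>. B.T s (D \<eta>) e) u = A.T r (\<lambda>\<eta>. \<Sum>q\<in>patterns. B.T s (cylinder n q) e * D \<eta> q) u"
    by (rule A.T_cong[OF assms(1,3)])
      (simp only: B.T_expansion[OF assms(2,4) D1] mult.commute)
  also have "\<dots> = (\<Sum>q\<in>patterns. B.T s (cylinder n q) e * A.T r (\<lambda>\<eta>. D \<eta> q) u)"
    by (rule A.T_sum[OF assms(1,3) D2])
  finally show ?thesis .
qed

text \<open>The time \<open>t\<close> is divided between the two processes. Increasing
  \<open>s\<close> applies the generator of the second one and withdraws that of the first, which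
  leaves exactly the discrepancy.\<close>

lemma iterated_derivative:
  assumes s: "0 \<le> s" "s \<le> t" and u: "u \<in> space A.S" and e: "e \<in> space B.S"
  shows "((\<lambda>s. A.T (t - s) (\<lambda>\<eta>. B.T s (D \<eta>) e) u) has_real_derivative
    A.T (t - s) (\<lambda>\<eta>. B.T s (discrepancy \<eta>) e) u) (at s within {0..t})"
proof -
  have deriv: "((\<lambda>s. B.T s (cylinder n q) e * A.T (t - s) (\<lambda>\<eta>. D \<eta> q) u) has_real_derivative
      B.T s (B.L (cylinder n q)) e * A.T (t - s) (\<lambda>\<eta>. D \<eta> q) u +
      - A.T (t - s) (A.L (\<lambda>\<xi>. D \<xi> q)) u * B.T s (cylinder n q) e) (at s within {0..t})" for q
  proof (rule DERIV_mult)
    show "((\<lambda>s. B.T s (cylinder n q) e) has_real_derivative B.T s (B.L (cylinder n q)) e) (at s within {0..t})"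
      by (rule has_field_derivative_subset[OF B.T_has_derivative[OF local_on_cylinder s(1) e]]) simp
    show "((\<lambda>s. A.T (t - s) (\<lambda>\<eta>. D \<eta> q) u) has_real_derivative
        - A.T (t - s) (A.L (\<lambda>\<xi>. D \<xi> q)) u) (at s within {0..t})"
      by (rule A.T_reverse_derivative[OF D2 u s])
  qed
  have "((\<lambda>s. \<Sum>q\<in>patterns. B.T s (cylinder n q) e * A.T (t - s) (\<lambda>\<eta>. D \<eta> q) u) has_real_derivative
      (\<Sum>q\<in>patterns. B.T s (B.L (cylinder n q)) e * A.T (t - s) (\<lambda>\<eta>. D \<eta> q) u +
      - A.T (t - s) (A.L (\<lambda>\<xi>. D \<xi> q)) u * B.T s (cylinder n q) e)) (at s within {0..t})"
    by (rule DERIV_sum) (rule deriv)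
  also have "(\<Sum>q\<in>patterns. B.T s (B.L (cylinder n q)) e * A.T (t - s) (\<lambda>\<eta>. D \<eta> q) u +
      - A.T (t - s) (A.L (\<lambda>\<xi>. D \<xi> q)) u * B.T s (cylinder n q) e)
      = A.T (t - s) (\<lambda>\<eta>. B.T s (discrepancy \<eta>) e) u"
    by (subst iterated_discrepancy(2)) (use s u e in \<open>simp_all add: sum_subtractf mult.commute\<close>)
  finally show ?thesis
  proof (rule has_field_derivative_transform_within)
    show "(0::real) < 1" by simp
    show "s \<in> {0..t}" using s by simp
    fix r assume "r \<in> {0..t}"
    then show "(\<Sum>q\<in>patterns. B.T r (cylinder n q) e * A.T (t - r) (\<lambda>\<eta>. D \<eta> q) u) =
        A.T (t - r) (\<lambda>\<eta>. B.T r (D \<eta>) e) u"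
      by (intro iterated_expansion[symmetric] u e) auto
  qed
qed

text \<open>The interpolation runs from the expectation over the first process at
  \<open>s = 0\<close> to that over the second at \<open>s = t\<close>. By the mean value theorem
  the two differ by at most \<open>t\<close> times a bound on the expected discrepancy.\<close>

lemma duality_error:
  assumes t: "0 \<le> t" and u: "u \<in> space A.S" and e: "e \<in> space B.S"
    and f: "local_on C m f" and g: "local_on C' m g"
    and le: "\<And>\<eta> \<zeta>. \<eta> \<in> space A.S \<Longrightarrow> \<zeta> \<in> space B.S \<Longrightarrow> \<bar>discrepancy \<eta> \<zeta>\<bar> \<le> f \<eta> + g \<zeta>"
    and K: "\<And>s. 0 \<le> s \<Longrightarrow> s \<le> t \<Longrightarrow> A.T s f u \<le> K" "\<And>s. 0 \<le> s \<Longrightarrow> s \<le> t \<Longrightarrow> B.T s g e \<le> K'"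
  shows "\<bar>A.T t (\<lambda>\<eta>. D \<eta> e) u - B.T t (D u) e\<bar> \<le> t * (K + K')"
proof (cases "t = 0")
  case True
  show ?thesis
    unfolding True using A.T_0[OF u D2, of e] B.T_0[OF e D1, of u] by simp
next
  case False
  then have "0 < t" using t by simp
  have bound: "\<bar>A.T (t - s) (\<lambda>\<eta>. B.T s (discrepancy \<eta>) e) u\<bar> \<le> K + K'" if s: "0 \<le> s" "s \<le> t" for s
  proof -
    have ts: "0 \<le> t - s" "t - s \<le> t" using s by auto
    interpret pA: prob_space "P (t - s) u" by (rule A.prob_space_P[OF ts(1) u])
    interpret pB: prob_space "P' s e" by (rule B.prob_space_P[OF s(1) e])
    have g_int: "integrable (P' s e) g" by (rule B.integrable_local[OF s(1) e g])
    have f_int: "integrable (P (t - s) u) f" by (rule A.integrable_local[OF ts(1) u f])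
    \<comment> \<open>The part \<open>f \<eta>\<close> is constant under the second process and is
      averaged over the first one only afterwards.\<close>
    have inner: "\<bar>B.T s (discrepancy \<eta>) e\<bar> \<le> f \<eta> + K'" if \<eta>: "\<eta> \<in> space A.S" for \<eta>
    proof -
      have "\<bar>B.T s (discrepancy \<eta>) e\<bar> \<le> B.T s (\<lambda>\<zeta>. f \<eta> + g \<zeta>) e"
        by (rule B.T_abs_mono[OF s(1) e integrable_discrepancy(1)[OF s(1) \<eta> e] _ le[OF \<eta>]])
          (simp add: g_int)
      also have "\<dots> = f \<eta> + B.T s g e"
        unfolding B.T_def by (subst Bochner_Integration.integral_add[OF _ g_int]) (simp_all add: pB.prob_space)
      finally show ?thesis using K(2)[OF s] by simp
    qed
    have "\<bar>A.T (t - s) (\<lambda>\<eta>. B.T s (discrepancy \<eta>) e) u\<bar> \<le> A.T (t - s) (\<lambda>\<eta>. f \<eta> + K') u"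
      by (rule A.T_abs_mono[OF ts(1) u iterated_discrepancy(1)[OF ts(1) s(1) u e] _ inner])
        (simp add: f_int)
    also have "\<dots> = A.T (t - s) f u + K'"
      unfolding A.T_def by (subst Bochner_Integration.integral_add[OF f_int]) (simp_all add: pA.prob_space)
    finally show ?thesis using K(1)[OF ts] by simp
  qed
  have "((\<lambda>s. A.T (t - s) (\<lambda>\<eta>. B.T s (D \<eta>) e) u) has_derivative
      (*) (A.T (t - s) (\<lambda>\<eta>. B.T s (discrepancy \<eta>) e) u)) (at s within {0..t})"
    if "0 \<le> s" "s \<le> t" for s
    using iterated_derivative[OF that u e] by (simp only: has_field_derivative_def)
  from mvt_simple[OF \<open>0 < t\<close> this] obtain x where x: "x \<in> {0<..<t}"
    "A.T (t - t) (\<lambda>\<eta>. B.T t (D \<eta>) e) u - A.T (t - 0) (\<lambda>\<eta>. B.T 0 (D \<eta>) e) u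
      = A.T (t - x) (\<lambda>\<eta>. B.T x (discrepancy \<eta>) e) u * (t - 0)" by (rule bexE)
  \<comment> \<open>At \<open>s = t\<close> the first semigroup runs for time 0, which is the
    identity on local functions; locality of the inner expectation in \<open>\<eta>\<close> comes
    from that of \<open>D\<close>.\<close>
  have "A.T (t - t) (\<lambda>\<eta>. B.T t (D \<eta>) e) u = B.T t (D u) e"
  proof -
    have "local_on C n (\<lambda>\<eta>. B.T t (D \<eta>) e)"
    proof (rule local_onI)
      fix \<eta> \<xi> assume sp: "\<eta> \<in> space A.S" "\<xi> \<in> space A.S"
        and eq: "\<And>x. 1 \<le> x \<Longrightarrow> x \<le> n \<Longrightarrow> \<eta> x = \<xi> x"
      have "D \<eta> = D \<xi>" by (rule ext) (rule local_onD[OF D2 sp eq])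
      then show "B.T t (D \<eta>) e = B.T t (D \<xi>) e" by simp
    qed
    from A.T_0[OF u this] show ?thesis by simp
  qed
  moreover have "A.T (t - 0) (\<lambda>\<eta>. B.T 0 (D \<eta>) e) u = A.T t (\<lambda>\<eta>. D \<eta> e) u"
    by (simp add: B.T_0[OF e D1])
  ultimately have "\<bar>A.T t (\<lambda>\<eta>. D \<eta> e) u - B.T t (D u) e\<bar>
      = t * \<bar>A.T (t - x) (\<lambda>\<eta>. B.T x (discrepancy \<eta>) e) u\<bar>"
    using x(2) t by (simp add: abs_mult abs_minus_commute)
  also have "\<dots> \<le> t * (K + K')"
    by (rule mult_left_mono[OF bound t]) (use x(1) in auto)
  finally show ?thesis .
qed

end

section \<open>Height functions and the duality function\<close>

text \<open>The height function cut off at \<open>n\<close>. The argument \<open>z\<close> labels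
  the bond \<open>(z, z + 1)\<close>; \<open>z = 0\<close> is the boundary, where injection
  acts.\<close>

definition below :: "nat \<Rightarrow> enat \<Rightarrow> config \<Rightarrow> nat \<Rightarrow> int" where
  "below n c \<eta> z = (\<Sum>x\<in>{z<..n}. of_bool (\<eta> x \<le> c))"

lemma below_cong:
  "(\<And>x. z < x \<Longrightarrow> x \<le> n \<Longrightarrow> \<eta> x \<le> c \<longleftrightarrow> \<xi> x \<le> c) \<Longrightarrow> below n c \<eta> z = below n c \<xi> z"
  unfolding below_def by (intro sum.cong) auto

lemma below_Suc: "z < n \<Longrightarrow> below n c \<eta> z = of_bool (\<eta> (Suc z) \<le> c) + below n c \<eta> (Suc z)"
proof -
  assume "z < n"
  then have "{z<..n} = insert (Suc z) {Suc z<..n}" by auto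
  then show ?thesis by (simp add: below_def)
qed

lemma below_last: "z < n \<Longrightarrow> below n c \<eta> z = of_bool (\<eta> n \<le> c) + (\<Sum>x\<in>{z<..<n}. of_bool (\<eta> x \<le> c))"
proof -
  assume "z < n"
  then have "{z<..n} = insert n {z<..<n}" by auto
  then show ?thesis by (simp add: below_def)
qed

lemma below_split:
  assumes "z \<le> w" "w \<le> n"
  shows "below n c \<eta> z = below w c \<eta> z + below n c \<eta> w"
proof -
  have "{z<..n} = {z<..w} \<union> {w<..n}" using assms by auto
  then show ?thesis
    unfolding below_def by (subst sum.union_disjoint[symmetric]) auto
qed

lemma below_diff:
  assumes "z \<le> w" "w \<le> n"
  shows "below n c \<eta> w \<le> below n c \<eta> z" "below n c \<eta> z \<le> below n c \<eta> w + int (w - z)"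
proof -
  have eq: "below n c \<eta> z = (\<Sum>x\<in>{z<..w}. of_bool (\<eta> x \<le> c)) + below n c \<eta> w"
    using below_split[OF assms] by (simp add: below_def)
  show "below n c \<eta> w \<le> below n c \<eta> z"
    unfolding eq by (simp add: sum_nonneg)
  have "(\<Sum>x\<in>{z<..w}. of_bool (\<eta> x \<le> c)) \<le> (\<Sum>x\<in>{z<..w}. 1::int)"
    by (intro sum_mono) simp
  then show "below n c \<eta> z \<le> below n c \<eta> w + int (w - z)" unfolding eq by simp
qed

text \<open>For \<open>z < x\<close> both sites are counted and for \<open>z > x\<close> neither is,
  so only the height at \<open>x\<close> can change. Contents on the same side of \<open>c\<close>
  are interchangeable, so each threshold sees a single-species jump.\<close>

lemma below_exchange:
  assumes "1 \<le> x" "x < n"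
  shows "below n c (exchange x \<eta>) z
    = below n c \<eta> z + of_bool (z = x \<and> \<eta> x \<le> c \<and> c < \<eta> (x + 1))"
proof (cases "\<eta> x < \<eta> (x + 1)")
  case False
  then show ?thesis by (auto simp: exchange_def)
next
  case True
  have other: "exchange x \<eta> y = \<eta> y" if "y \<noteq> x" "y \<noteq> x + 1" for y
    using that by (simp add: exchange_def)
  have swapped: "exchange x \<eta> x = \<eta> (x + 1)" "exchange x \<eta> (x + 1) = \<eta> x"
    using True by (simp_all add: exchange_def)
  consider "z > x" | "z = x" | "z < x" by linarith
  then show ?thesis
  proof cases
    case 1
    have "below n c (exchange x \<eta>) z = below n c \<eta> z"
      by (rule below_cong) (use 1 other in auto)
    then show ?thesis using 1 by simp
  next
    case 2
    have "below n c (exchange x \<eta>) (Suc x) = below n c \<eta> (Suc x)"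
      by (rule below_cong) (use other in auto)
    then have "below n c (exchange x \<eta>) x = of_bool (\<eta> x \<le> c) + below n c \<eta> (Suc x)"
      "below n c \<eta> x = of_bool (\<eta> (x + 1) \<le> c) + below n c \<eta> (Suc x)"
      using below_Suc[OF assms(2), of c] swapped by simp_all
    moreover have "of_bool (\<eta> x \<le> c) = of_bool (\<eta> (x + 1) \<le> c) + (of_bool (\<eta> x \<le> c \<and> c < \<eta> (x + 1)) :: int)"
      using True by (auto simp: not_le)
    ultimately show ?thesis
      using 2 by simp
  next
    case 3
    have sub: "{z<..n} = insert x (insert (x + 1) ({z<..n} - {x, x + 1}))"
      using 3 assms by auto
    have "(\<Sum>y\<in>{z<..n} - {x, x + 1}. of_bool (exchange x \<eta> y \<le> c))
        = (\<Sum>y\<in>{z<..n} - {x, x + 1}. of_bool (\<eta> y \<le> c) :: int)"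
      by (intro sum.cong) (auto simp: other)
    then show ?thesis
      using 3 swapped unfolding below_def by (subst (1 2) sub) (simp del: sum_of_bool_eq)
  qed
qed

text \<open>For \<open>c = 2\<close> the replacement of a second-class particle by a first-class one
  is invisible; for \<open>c = 1\<close> it is an injection into a hole.\<close>

lemma below_inject:
  assumes "1 \<le> n" "1 \<le> c"
  shows "below n c (inject \<eta>) z = below n c \<eta> z + of_bool (z = 0 \<and> c < \<eta> 1)"
proof (cases "z = 0")
  case True
  have "below n c (inject \<eta>) 1 = below n c \<eta> 1"
    by (rule below_cong) (simp add: inject_def)
  then have "below n c (inject \<eta>) 0 = of_bool (inject \<eta> 1 \<le> c) + below n c \<eta> 1"
    "below n c \<eta> 0 = of_bool (\<eta> 1 \<le> c) + below n c \<eta> 1"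
    using below_Suc[of 0 n c] assms by simp_all
  moreover have "of_bool (inject \<eta> 1 \<le> c) = of_bool (\<eta> 1 \<le> c) + (of_bool (c < \<eta> 1) :: int)"
    using assms(2) by (auto simp: inject_def not_le)
  ultimately show ?thesis
    using True by simp
next
  case False
  have "below n c (inject \<eta>) z = below n c \<eta> z"
    by (rule below_cong) (use False in \<open>auto simp: inject_def\<close>)
  then show ?thesis using False by simp
qed

text \<open>Site \<open>n + 1\<close> lies outside the window, so a particle jumping there is lost
  for every height left of \<open>n\<close>.\<close>

lemma below_exchange_last:
  assumes "1 \<le> n"
  shows "below n c (exchange n \<eta>) z
    = below n c \<eta> z - of_bool (z < n \<and> \<eta> n \<le> c \<and> c < \<eta> (n + 1))"
proof (cases "z < n")
  case True
  have "(\<Sum>x\<in>{z<..<n}. of_bool (exchange n \<eta> x \<le> c)) = (\<Sum>x\<in>{z<..<n}. of_bool (\<eta> x \<le> c) :: int)"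
    by (intro sum.cong) (auto simp: exchange_def)
  then show ?thesis
    using True by (auto simp: below_last exchange_def)
next
  case False
  then show ?thesis by (simp add: below_def)
qed

section \<open>Minima of functions raised at one point\<close>

lemma Min_bump_eq:
  fixes f :: "nat \<Rightarrow> int"
  assumes Z: "finite Z" and y: "y \<in> Z" "y \<noteq> x" "f y = f x"
  shows "Min ((\<lambda>z. f z + of_bool (z = x \<and> A)) ` Z) = Min (f ` Z)"
proof (rule antisym)
  have "Min (f ` Z) \<in> f ` Z" using assms by (intro Min_in) auto
  then obtain w where w: "w \<in> Z" "Min (f ` Z) = f w" by auto
  \<comment> \<open>A minimizer other than \<open>x\<close>: if the minimum was found at
    \<open>x\<close>, the tied point \<open>y\<close> replaces it.\<close>
  define v where "v = (if w = x then y else w)"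
  have v: "v \<in> Z" "f v + of_bool (v = x \<and> A) = f w" using w y by (auto simp: v_def)
  have "Min ((\<lambda>z. f z + of_bool (z = x \<and> A)) ` Z) \<le> f v + of_bool (v = x \<and> A)"
    using Z v(1) by (intro Min_le finite_imageI image_eqI[of _ _ v]) auto
  then show "Min ((\<lambda>z. f z + of_bool (z = x \<and> A)) ` Z) \<le> Min (f ` Z)"
    using v w by simp
next
  have "Min (f ` Z) \<le> f z + of_bool (z = x \<and> A)" if "z \<in> Z" for z
  proof -
    have "Min (f ` Z) \<le> f z" using Z that by (intro Min_le) auto
    then show ?thesis by (cases "z = x \<and> A") auto
  qed
  then show "Min (f ` Z) \<le> Min ((\<lambda>z. f z + of_bool (z = x \<and> A)) ` Z)"
    using Z y by (intro Min.boundedI) auto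
qed

text \<open>Two bumps at \<open>x\<close> may differ only if the value there is tied with another
  one; then the minimum sees neither of them.\<close>

lemma Min_bump:
  fixes f :: "nat \<Rightarrow> int"
  assumes "finite Z" and "A \<noteq> B \<Longrightarrow> \<exists>y\<in>Z. y \<noteq> x \<and> f y = f x"
  shows "Min ((\<lambda>z. f z + of_bool (z = x \<and> A)) ` Z) = Min ((\<lambda>z. f z + of_bool (z = x \<and> B)) ` Z)"
proof (cases "A = B")
  case False
  then obtain y where y: "y \<in> Z" "y \<noteq> x" "f y = f x" using assms(2) by auto
  show ?thesis
    using Min_bump_eq[of Z y x f A] Min_bump_eq[of Z y x f B] assms(1) y by simp
qed simp

lemma Min_diff_le:
  fixes f g :: "nat \<Rightarrow> int"
  assumes Z: "finite Z" "Z \<noteq> {}" and close: "\<And>z. z \<in> Z \<Longrightarrow> \<bar>f z - g z\<bar> \<le> d"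
  shows "\<bar>Min (f ` Z) - Min (g ` Z)\<bar> \<le> d"
proof -
  have *: "Min (f ` Z) \<le> Min (g ` Z) + d" if close: "\<And>z. z \<in> Z \<Longrightarrow> \<bar>f z - g z\<bar> \<le> d"
    for f g :: "nat \<Rightarrow> int"
  proof -
    have "Min (g ` Z) \<in> g ` Z" using Z by (intro Min_in) auto
    then obtain w where w: "w \<in> Z" "Min (g ` Z) = g w" by auto
    have "Min (f ` Z) \<le> f w" using Z w by (intro Min_le) auto
    then show ?thesis using w close[OF w(1)] by simp
  qed
  have "Min (f ` Z) \<le> Min (g ` Z) + d" by (rule *) (rule close)
  moreover have "Min (g ` Z) \<le> Min (f ` Z) + d"
    by (rule *) (use close in \<open>simp add: abs_minus_commute\<close>)
  ultimately show ?thesis by simp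
qed

text \<open>The contents at most \<open>c\<close> count as particles of the first argument: a second-class particle is
  a hole for \<open>c = 1\<close> and a particle for \<open>c = 2\<close>.\<close>

definition cost :: "nat \<Rightarrow> enat \<Rightarrow> config \<Rightarrow> config \<Rightarrow> nat \<Rightarrow> int" where
  "cost n c \<eta> \<zeta> z = int z + below n c \<eta> z + below n 1 \<zeta> z"

definition dual :: "nat \<Rightarrow> enat \<Rightarrow> config \<Rightarrow> config \<Rightarrow> int" where
  "dual n c \<eta> \<zeta> = Min (cost n c \<eta> \<zeta> ` {0..n})"

lemma dual_cong:
  assumes "\<And>x. 1 \<le> x \<Longrightarrow> x \<le> n \<Longrightarrow> \<eta> x = \<eta>' x" "\<And>x. 1 \<le> x \<Longrightarrow> x \<le> n \<Longrightarrow> \<zeta> x = \<zeta>' x"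
  shows "dual n c \<eta> \<zeta> = dual n c \<eta>' \<zeta>'"
proof -
  have "below n c \<eta> z = below n c \<eta>' z" "below n 1 \<zeta> z = below n 1 \<zeta>' z" for z
    by (rule below_cong, use assms in simp)+
  then show ?thesis by (simp add: dual_def cost_def)
qed

text \<open>The cost is flat across a site exactly when just one of the two configurations has a
  particle there. Such sites provide the ties for \<open>Min_bump\<close>.\<close>

lemma cost_Suc:
  assumes "z < n"
  shows "cost n c \<eta> \<zeta> (Suc z)
    = cost n c \<eta> \<zeta> z + of_bool (c < \<eta> (Suc z)) - of_bool (\<zeta> (Suc z) \<le> 1)"
  using assms by (auto simp: cost_def below_Suc not_less)

text \<open>If the swap is a jump in just one of the configurations, the other lacks a particle at
  \<open>x\<close> or a hole at \<open>x + 1\<close>. At that site exactly one of them has a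
  particle, so the cost at \<open>x\<close> is tied with the cost at \<open>x - 1\<close> or
  \<open>x + 1\<close>.\<close>

lemma dual_exchange:
  assumes x: "1 \<le> x" "x < n"
  shows "dual n c (exchange x \<eta>) \<zeta> = dual n c \<eta> (exchange x \<zeta>)"
proof -
  let ?A = "\<eta> x \<le> c \<and> c < \<eta> (x + 1)" and ?B = "\<zeta> x \<le> 1 \<and> 1 < \<zeta> (x + 1)"
  have "cost n c (exchange x \<eta>) \<zeta> = (\<lambda>z. cost n c \<eta> \<zeta> z + of_bool (z = x \<and> ?A))"
    "cost n c \<eta> (exchange x \<zeta>) = (\<lambda>z. cost n c \<eta> \<zeta> z + of_bool (z = x \<and> ?B))"
    by (auto simp: cost_def below_exchange[OF x] fun_eq_iff)
  moreover have "Min ((\<lambda>z. cost n c \<eta> \<zeta> z + of_bool (z = x \<and> ?A)) ` {0..n})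
      = Min ((\<lambda>z. cost n c \<eta> \<zeta> z + of_bool (z = x \<and> ?B)) ` {0..n})"
  proof (rule Min_bump)
    assume "?A \<noteq> ?B"
    obtain k where k: "x = Suc k" using x by (cases x) auto
    have "cost n c \<eta> \<zeta> (Suc x) = cost n c \<eta> \<zeta> x \<or> cost n c \<eta> \<zeta> k = cost n c \<eta> \<zeta> x"
      using \<open>?A \<noteq> ?B\<close> x cost_Suc[of x n c \<eta> \<zeta>] cost_Suc[of k n c \<eta> \<zeta>]
      by (auto simp: k not_less not_le)
    then show "\<exists>y\<in>{0..n}. y \<noteq> x \<and> cost n c \<eta> \<zeta> y = cost n c \<eta> \<zeta> x"
    proof
      assume "cost n c \<eta> \<zeta> (Suc x) = cost n c \<eta> \<zeta> x"
      then show ?thesis using x by (intro bexI[of _ "Suc x"]) auto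
    next
      assume "cost n c \<eta> \<zeta> k = cost n c \<eta> \<zeta> x"
      then show ?thesis using x k by (intro bexI[of _ k]) auto
    qed
  qed simp
  ultimately show ?thesis by (simp add: dual_def)
qed

text \<open>If only one of the configurations accepts the injection, site 1 is occupied in exactly
  one of them, and the costs at 0 and 1 are tied.\<close>

lemma dual_inject:
  assumes n: "1 \<le> n" "1 \<le> c"
  shows "dual n c (inject \<eta>) \<zeta> = dual n c \<eta> (inject \<zeta>)"
proof -
  let ?A = "c < \<eta> 1" and ?B = "1 < \<zeta> 1"
  have "cost n c (inject \<eta>) \<zeta> = (\<lambda>z. cost n c \<eta> \<zeta> z + of_bool (z = 0 \<and> ?A))"
    "cost n c \<eta> (inject \<zeta>) = (\<lambda>z. cost n c \<eta> \<zeta> z + of_bool (z = 0 \<and> ?B))"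
    using n by (auto simp: cost_def below_inject fun_eq_iff)
  moreover have "Min ((\<lambda>z. cost n c \<eta> \<zeta> z + of_bool (z = 0 \<and> ?A)) ` {0..n})
      = Min ((\<lambda>z. cost n c \<eta> \<zeta> z + of_bool (z = 0 \<and> ?B)) ` {0..n})"
  proof (rule Min_bump)
    assume "?A \<noteq> ?B"
    then have "cost n c \<eta> \<zeta> 1 = cost n c \<eta> \<zeta> 0"
      using n cost_Suc[of 0 n c \<eta> \<zeta>] by (auto simp: not_less not_le)
    then show "\<exists>y\<in>{0..n}. y \<noteq> 0 \<and> cost n c \<eta> \<zeta> y = cost n c \<eta> \<zeta> 0"
      using n by (intro bexI[of _ 1]) auto
  qed simp
  ultimately show ?thesis by (simp add: dual_def)
qed

text \<open>At the edge of the window there is no point \<open>n + 1\<close> to tie with, so duality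
  may fail. A jump out of the window needs a particle at \<open>n\<close> and changes each height,
  hence the minimum, by at most one.\<close>

lemma dual_exchange_last:
  assumes "1 \<le> n"
  shows "\<bar>dual n c (exchange n \<eta>) \<zeta> - dual n c \<eta> \<zeta>\<bar> \<le> of_bool (\<eta> n \<noteq> \<infinity>)"
    and "\<bar>dual n c \<eta> (exchange n \<zeta>) - dual n c \<eta> \<zeta>\<bar> \<le> of_bool (\<zeta> n \<noteq> \<infinity>)"
proof -
  have "\<xi> n \<noteq> \<infinity>" if "\<xi> n \<le> d" "d < \<xi> (n + 1)" for \<xi> :: config and d
  proof
    assume "\<xi> n = \<infinity>"
    with that show False by simp
  qed
  then have "\<bar>below n d (exchange n \<xi>) z - below n d \<xi> z\<bar> \<le> of_bool (\<xi> n \<noteq> \<infinity>)" for \<xi> d z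
    unfolding below_exchange_last[OF assms] by auto
  then have "\<bar>cost n c (exchange n \<eta>) \<zeta> z - cost n c \<eta> \<zeta> z\<bar> \<le> of_bool (\<eta> n \<noteq> \<infinity>)"
    "\<bar>cost n c \<eta> (exchange n \<zeta>) z - cost n c \<eta> \<zeta> z\<bar> \<le> of_bool (\<zeta> n \<noteq> \<infinity>)" for z
    by (simp_all add: cost_def)
  then show "\<bar>dual n c (exchange n \<eta>) \<zeta> - dual n c \<eta> \<zeta>\<bar> \<le> of_bool (\<eta> n \<noteq> \<infinity>)"
    "\<bar>dual n c \<eta> (exchange n \<zeta>) - dual n c \<eta> \<zeta>\<bar> \<le> of_bool (\<zeta> n \<noteq> \<infinity>)"
    unfolding dual_def by (intro Min_diff_le; simp)+
qed

text \<open>The height falls by at most one per site, so without particles of \<open>\<zeta>\<close>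
  the cost is nondecreasing in \<open>z\<close> and its minimum is at 0.\<close>

lemma dual_no_particles:
  assumes "\<And>x. 1 \<le> x \<Longrightarrow> x \<le> n \<Longrightarrow> \<zeta> x > 1"
  shows "dual n c \<eta> \<zeta> = below n c \<eta> 0"
proof -
  have 0: "below n 1 \<zeta> z = 0" for z
    unfolding below_def by (intro sum.neutral) (use assms in \<open>auto simp: not_le\<close>)
  have "Min (cost n c \<eta> \<zeta> ` {0..n}) = below n c \<eta> 0"
  proof (rule Min_eqI)
    fix y assume "y \<in> cost n c \<eta> \<zeta> ` {0..n}"
    then obtain z where z: "z \<le> n" "y = int z + below n c \<eta> z"
      by (auto simp: cost_def 0)
    then show "below n c \<eta> 0 \<le> y" using below_diff(2)[of 0 z n c \<eta>] by simp
  next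
    show "below n c \<eta> 0 \<in> cost n c \<eta> \<zeta> ` {0..n}"
      by (rule image_eqI[of _ _ 0]) (simp_all add: cost_def 0)
  qed simp
  then show ?thesis by (simp add: dual_def)
qed

text \<open>The height of the block is constant up to \<open>m\<close>, has slope -1 from
  \<open>m\<close> to \<open>l\<close> and vanishes from \<open>l\<close> on, while that of
  \<open>\<zeta>\<close> falls by 0 or 1 per site. So the cost weakly increases up to
  \<open>m\<close>, weakly decreases up to \<open>l\<close> and weakly increases afterwards: its
  minimum is at 0 or at \<open>l\<close>.\<close>

lemma dual_block:
  assumes "m \<le> l" "l \<le> n" and block: "\<And>x. 1 \<le> x \<Longrightarrow> x \<le> n \<Longrightarrow> \<eta> x \<le> c \<longleftrightarrow> m < x \<and> x \<le> l"
  shows "dual n c \<eta> \<zeta> = int (l - m) + below n 1 \<zeta> l + min (below n 1 \<zeta> 0 - below n 1 \<zeta> l) (int m)"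
proof -
  have bl: "below n c \<eta> z = int (l - max m z)" for z
  proof -
    have "below n c \<eta> z = (\<Sum>x\<in>{max m z<..l}. 1)"
      unfolding below_def
      by (rule sum.mono_neutral_cong_right) (use assms block in auto)
    then show ?thesis by simp
  qed
  let ?k = "below n 1 \<zeta>"
  let ?r = "int (l - m) + ?k l + min (?k 0 - ?k l) (int m)"
  have "Min (cost n c \<eta> \<zeta> ` {0..n}) = ?r"
  proof (rule Min_eqI)
    fix y assume "y \<in> cost n c \<eta> \<zeta> ` {0..n}"
    then obtain z where z: "z \<le> n" "y = int z + int (l - max m z) + ?k z"
      by (auto simp: cost_def bl)
    consider "z \<le> m" | "m \<le> z" "z \<le> l" | "l \<le> z" by linarith
    then show "?r \<le> y"
    proof cases
      case 1
      then show ?thesis using z below_diff(2)[of 0 z n 1 \<zeta>] by (simp add: max_def)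
    next
      case 2
      then show ?thesis using z assms below_diff(1)[of z l n 1 \<zeta>] by (simp add: max_def)
    next
      case 3
      then show ?thesis using z assms below_diff(2)[of l z n 1 \<zeta>] by (simp add: max_def)
    qed
  next
    show "?r \<in> cost n c \<eta> \<zeta> ` {0..n}"
    \<comment> \<open>The minimum is at 0 if \<open>\<zeta>\<close> has at most \<open>m\<close>
      particles in \<open>{1..l}\<close>, and at \<open>l\<close> otherwise.\<close>
    proof (cases "?k 0 - ?k l \<le> int m")
      case True
      then show ?thesis
        by (intro image_eqI[of _ _ 0]) (simp_all add: cost_def bl)
    next
      case False
      then show ?thesis
        using assms by (intro image_eqI[of _ _ l]) (simp_all add: cost_def bl max_def)
    qed
  qed simp
  then show ?thesis by (simp add: dual_def)
qed

section \<open>The number of second-class particles\<close>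

text \<open>For contents 1, 2 and \<open>\<infinity>\<close> this is the number of second-class
  particles in the window. As a difference of heights it inherits their behaviour under the
  moves.\<close>

definition twos :: "nat \<Rightarrow> config \<Rightarrow> int" where
  "twos n \<eta> = below n 2 \<eta> 0 - below n 1 \<eta> 0"

lemma one_less_two_enat: "(1::enat) < 2" "(1::enat) \<le> 2"
  using enat_ord_simps(2)[of 1 2] by (simp_all add: one_enat_def numeral_eq_enat)

lemma twos_eq_card:
  assumes "\<eta> \<in> space (config_space {1, 2, \<infinity>})"
  shows "twos n \<eta> = int (card {x\<in>{1..n}. \<eta> x = 2})"
proof -
  have "of_bool (\<eta> x \<le> 2) - of_bool (\<eta> x \<le> 1) = (of_bool (\<eta> x = 2) :: int)" if "x \<ge> 1" for x
  proof -
    have "\<not> (2::enat) \<le> 1" using one_less_two_enat(1) by simp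
    moreover have "\<eta> x = 1 \<or> \<eta> x = 2 \<or> \<eta> x = \<infinity>"
      using config_value[OF assms that] by simp
    ultimately show ?thesis using one_less_two_enat by auto
  qed
  then have "twos n \<eta> = (\<Sum>x\<in>{0<..n}. of_bool (\<eta> x = 2))"
    unfolding twos_def below_def sum_subtractf[symmetric] by (intro sum.cong) auto
  also have "\<dots> = int (card ({0<..n} \<inter> {x. \<eta> x = 2}))" by simp
  also have "{0<..n} \<inter> {x. \<eta> x = 2} = {x\<in>{1..n}. \<eta> x = 2}" by auto
  finally show ?thesis .
qed

definition many_twos :: "nat \<Rightarrow> config \<Rightarrow> real" where
  "many_twos n \<eta> = of_bool (twos n \<eta> \<ge> 2)"

lemma twos_cong:
  assumes "\<And>x. 1 \<le> x \<Longrightarrow> x \<le> n \<Longrightarrow> \<eta> x = \<xi> x"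
  shows "twos n \<eta> = twos n \<xi>"
proof -
  have "below n c \<eta> 0 = below n c \<xi> 0" for c
    by (rule below_cong) (use assms in simp)
  then show ?thesis by (simp add: twos_def)
qed

lemma local_on_twos: "local_on C n (\<lambda>\<eta>. F (twos n \<eta>))"
  by (rule local_onI, rule arg_cong[where f = F], rule twos_cong)

lemma local_on_many_twos: "local_on C n (many_twos n)"
  unfolding many_twos_def by (rule local_on_twos)

text \<open>Swaps inside the window preserve the number of second-class particles, and injection can
  only remove one. Only the bond \<open>(n, n + 1)\<close> can bring in another, which needs a
  particle at \<open>n + 1\<close>.\<close>

lemma generator_many_twos_le:
  assumes \<eta>: "\<eta> \<in> space (config_space C)" and n: "1 \<le> n" and "0 \<le> \<alpha>"
  shows "tasep_generator \<alpha> (many_twos n) \<eta> \<le> occ (Suc n) \<eta>"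
proof -
  have "twos n (inject \<eta>) \<le> twos n \<eta>"
    using one_less_two_enat less_trans[of 1 2 "\<eta> 1"] n by (simp add: twos_def below_inject)
  then have inj: "\<alpha> * (many_twos n (inject \<eta>) - many_twos n \<eta>) \<le> 0"
    using \<open>0 \<le> \<alpha>\<close> by (intro mult_nonneg_nonpos) (auto simp: many_twos_def)
  have "many_twos n (exchange x \<eta>) - many_twos n \<eta> \<le> (if x = n then occ (Suc n) \<eta> else 0)"
    if x: "x \<in> {1..n}" for x
  proof (cases "x = n")
    case False
    then have "twos n (exchange x \<eta>) = twos n \<eta>"
      using x by (simp add: twos_def below_exchange)
    then show ?thesis using False by (simp add: many_twos_def)
  next
    case True
    show ?thesis
    proof (cases "\<eta> (Suc n) = \<infinity>")
      case hole: True
      \<comment> \<open>A first-class particle leaving the window lowers both heights, a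
        second-class one only the height for threshold 2.\<close>
      have "\<eta> n \<le> 1 \<Longrightarrow> \<eta> n \<le> 2"
        using one_less_two_enat(2) order_trans by blast
      then have "twos n (exchange n \<eta>) \<le> twos n \<eta>"
        using n hole by (auto simp: twos_def below_exchange_last)
      then show ?thesis using \<open>x = n\<close> by (auto simp: many_twos_def occ_def)
    next
      case False
      then show ?thesis using \<open>x = n\<close> by (simp add: many_twos_def occ_def)
    qed
  qed
  then have "(\<Sum>x\<in>{1..n}. many_twos n (exchange x \<eta>) - many_twos n \<eta>)
      \<le> (\<Sum>x\<in>{1..n}. if x = n then occ (Suc n) \<eta> else 0)"
    by (rule sum_mono)
  also have "\<dots> = occ (Suc n) \<eta>"
    using n by (subst sum.delta) auto
  finally show ?thesis
    unfolding generator_local_on[OF local_on_many_twos \<eta>] using inj by linarith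
qed

lemma pow_fact_tendsto: "(\<lambda>k. (t::real) ^ k / fact k) \<longlonglongrightarrow> 0"
  using summable_LIMSEQ_zero[OF summable_exp[of t]] by (simp add: field_simps)

context tasep_semigroup begin

text \<open>Monotonicity in time makes the bound uniform up to \<open>t\<close>, the form needed for
  \<open>duality_error\<close>.\<close>

lemma T_occ_le_horizon:
  assumes u: "u \<in> space S" "\<And>x. x > l \<Longrightarrow> u x = \<infinity>" and "1 \<le> l" "0 \<le> s" "s \<le> t"
  shows "T s (occ (l + k)) u \<le> t ^ k / fact k"
proof -
  have "T s (occ (l + k)) u \<le> s ^ k / fact k"
    by (rule T_occ_le[OF u assms(3,4)])
  also have "\<dots> \<le> t ^ k / fact k"
    by (intro divide_right_mono power_mono assms(4,5)) simp
  finally show ?thesis .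
qed

text \<open>A second second-class particle can only enter \<open>{1..n}\<close> from the site \<open>n + 1\<close>, and \<open>many_twos n\<close>
  increases with \<open>n\<close>; so its expectation is bounded by the probability that sites far away are
  reached.\<close>

lemma T_many_twos_eq_0:
  assumes C: "C = {1, 2, \<infinity>}" and "0 \<le> \<alpha>"
    and u: "u \<in> space S" "\<And>x. x > l \<Longrightarrow> u x = \<infinity>" and "1 \<le> l" "0 \<le> t"
    and start: "\<And>n. twos n u \<le> 1"
  shows "T t (many_twos n) u = 0"
proof (rule antisym)
  have le: "T t (many_twos n) u \<le> t ^ Suc k / fact (Suc k) * t" if k: "n \<le> l + k" for k
  proof -
    have mm: "many_twos n \<xi> \<le> many_twos (l + k) \<xi>" if "\<xi> \<in> space S" for \<xi>
    proof -
      have "card {x\<in>{1..n}. \<xi> x = 2} \<le> card {x\<in>{1..l + k}. \<xi> x = 2}"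
        using k by (intro card_mono) auto
      then have "twos n \<xi> \<le> twos (l + k) \<xi>"
        using that by (simp add: C twos_eq_card)
      then show ?thesis by (simp add: many_twos_def)
    qed
    have "T t (many_twos n) u \<le> T t (many_twos (l + k)) u"
      by (rule T_mono[OF \<open>0 \<le> t\<close> u(1) _ _ mm])
        (rule integrable_local[OF \<open>0 \<le> t\<close> u(1) local_on_many_twos])+
    also have "\<dots> \<le> t ^ Suc k / fact (Suc k) * t"
    \<comment> \<open>The bound on the derivative is constant up to \<open>t\<close>, so a linear
      majorant suffices.\<close>
    proof (rule T_upper[OF local_on_many_twos \<open>0 \<le> t\<close> u(1), where \<psi> = "(*) (t ^ Suc k / fact (Suc k))" and \<psi>' = "\<lambda>_. t ^ Suc k / fact (Suc k)"])
      show "many_twos (l + k) u \<le> t ^ Suc k / fact (Suc k) * 0"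
        using start[of "l + k"] by (simp add: many_twos_def)
      fix s assume s: "0 \<le> s" "s \<le> t"
      show "((*) (t ^ Suc k / fact (Suc k)) has_real_derivative t ^ Suc k / fact (Suc k)) (at s within {0..t})"
        using DERIV_cmult[OF DERIV_ident, of "t ^ Suc k / fact (Suc k)"] by simp
      have lk: "1 \<le> l + k" using \<open>1 \<le> l\<close> by simp
      have "T s (L (many_twos (l + k))) u \<le> T s (occ (Suc (l + k))) u"
        by (rule T_mono[OF s(1) u(1)
              integrable_local[OF s(1) u(1) local_L[OF local_on_many_twos]]
              integrable_local[OF s(1) u(1) local_on_occ]])
          (simp, rule generator_many_twos_le[OF _ lk \<open>0 \<le> \<alpha>\<close>])
      also have "\<dots> \<le> t ^ Suc k / fact (Suc k)"
        using T_occ_le_horizon[OF u \<open>1 \<le> l\<close> s, of "Suc k"] by simp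
      finally show "T s (L (many_twos (l + k))) u \<le> t ^ Suc k / fact (Suc k)" .
    qed
    finally show ?thesis .
  qed
  show "T t (many_twos n) u \<le> 0"
  proof (rule LIMSEQ_le_const)
    show "(\<lambda>k. t ^ Suc k / fact (Suc k) * t) \<longlonglongrightarrow> 0"
      using tendsto_mult_right[OF LIMSEQ_Suc[OF pow_fact_tendsto], of t t] by simp
    show "\<exists>N. \<forall>k\<ge>N. T t (many_twos n) u \<le> t ^ Suc k / fact (Suc k) * t"
      by (intro exI[of _ n] allI impI le) simp
  qed
  show "0 \<le> T t (many_twos n) u"
    unfolding T_def by (rule Bochner_Integration.integral_nonneg) (simp add: many_twos_def)
qed

end

section \<open>Duality for the one-shock configuration\<close>

context tasep_semigroup begin

lemma measure_P:
  assumes "t \<ge> 0" "\<eta> \<in> space S" and R: "{\<xi> \<in> space S. R \<xi>} \<in> sets S"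
  shows "measure (P t \<eta>) {\<xi> \<in> space S. R \<xi>} = T t (\<lambda>\<xi>. of_bool (R \<xi>)) \<eta>"
proof -
  have "T t (\<lambda>\<xi>. of_bool (R \<xi>)) \<eta> = T t (indicator {\<xi> \<in> space S. R \<xi>}) \<eta>"
    by (rule T_cong[OF assms(1,2)]) (simp add: indicator_def)
  also have "\<dots> = measure (P t \<eta>) {\<xi> \<in> space S. R \<xi>}"
    using sets.sets_into_space[OF R] assms(1,2) by (simp add: T_def Int_absorb2)
  finally show ?thesis ..
qed

text \<open>Borel-Cantelli with the summable bounds \<open>t ^ k / fact k\<close>. The result
  matters because \<open>particles_from\<close> counts by \<open>card\<close>, which is 0 on
  infinite sets.\<close>

lemma AE_finite_particles:
  assumes u: "u \<in> space S" "\<And>x. x > l \<Longrightarrow> u x = \<infinity>" and "1 \<le> l" "0 \<le> t"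
  shows "AE \<eta> in P t u. finite {x. 1 \<le> x \<and> \<eta> x \<noteq> \<infinity>}"
proof -
  interpret prob_space "P t u" by (rule prob_space_P[OF \<open>0 \<le> t\<close> u(1)])
  define A where "A k = {\<eta> \<in> space S. \<eta> (l + k) \<noteq> \<infinity>}" for k
  have A: "A k \<in> sets S" for k
    unfolding A_def by (rule predE, rule pred_site) (use \<open>1 \<le> l\<close> in simp)
  have sets_A: "A k \<in> events" for k
    using A by (simp only: sets_P[OF \<open>0 \<le> t\<close> u(1)])
  have bound: "measure (P t u) (A k) \<le> t ^ k / fact k" for k
  proof -
    have "measure (P t u) (A k) = T t (occ (l + k)) u"
      unfolding A_def occ_def[abs_def] by (rule measure_P[OF \<open>0 \<le> t\<close> u(1) A[unfolded A_def]])
    then show ?thesis using T_occ_le[OF u \<open>1 \<le> l\<close> \<open>0 \<le> t\<close>, of k] by (simp only:)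
  qed
  have "summable (\<lambda>k. t ^ k / fact k)"
    using summable_exp[of t] by (simp only: divide_inverse mult.commute)
  then have "summable (\<lambda>k. measure (P t u) (A k))"
    by (rule summable_comparison_test'[where N = 0])
      (simp only: real_norm_def abs_of_nonneg[OF measure_nonneg] bound)
  then have "AE \<eta> in P t u. eventually (\<lambda>k. \<eta> \<in> space (P t u) - A k) sequentially"
    by (rule borel_cantelli_AE1[OF sets_A, rotated]) (simp add: emeasure_eq_measure)
  then show ?thesis
  proof eventually_elim
    case (elim \<eta>)
    then obtain K where K: "\<And>k. k \<ge> K \<Longrightarrow> \<eta> \<in> space (P t u) - A k"
      unfolding eventually_sequentially by blast
    have "{x. 1 \<le> x \<and> \<eta> x \<noteq> \<infinity>} \<subseteq> {..<l + K}"
    proof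
      fix x assume x: "x \<in> {x. 1 \<le> x \<and> \<eta> x \<noteq> \<infinity>}"
      show "x \<in> {..<l + K}"
      proof (rule ccontr)
        assume "x \<notin> {..<l + K}"
        then have "x - l \<ge> K" "l + (x - l) = x" by auto
        with K[of "x - l"] x show False
          unfolding A_def space_P[OF \<open>0 \<le> t\<close> u(1)] by simp
      qed
    qed
    then show ?case by (rule finite_subset) simp
  qed
qed

lemma sets_twos: "{\<eta> \<in> space S. \<exists>x\<in>{1..n}. \<eta> x = 2} \<in> sets S"
  by (intro sets.sets_Collect_finite_Ex predE pred_site) auto

text \<open>Two second-class particles have probability 0, so \<open>twos n\<close> is almost surely
  0 or 1 and its expectation is the probability of the value 1.\<close>

lemma T_twos:
  assumes C: "C = {1, 2, \<infinity>}" and "0 \<le> t" "u \<in> space S" and many: "T t (many_twos n) u = 0"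
  shows "T t (\<lambda>\<eta>. real_of_int (twos n \<eta>)) u = measure (P t u) {\<eta> \<in> space S. \<exists>x\<in>{1..n}. \<eta> x = 2}"
proof -
  let ?r = "\<lambda>\<eta>. of_bool (1 \<le> twos n \<eta>) :: real"
  have pos: "1 \<le> twos n \<eta> \<longleftrightarrow> (\<exists>x\<in>{1..n}. \<eta> x = 2)" and ub: "twos n \<eta> \<le> int n" and nn: "0 \<le> twos n \<eta>"
    if "\<eta> \<in> space S" for \<eta>
  proof -
    have eq: "twos n \<eta> = int (card {x\<in>{1..n}. \<eta> x = 2})"
      by (rule twos_eq_card) (use that C in simp)
    have "card {x\<in>{1..n}. \<eta> x = 2} \<le> card {1..n}"
      by (rule card_mono) auto
    then show "twos n \<eta> \<le> int n" "0 \<le> twos n \<eta>" unfolding eq by simp_all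
    have "1 \<le> twos n \<eta> \<longleftrightarrow> card {x\<in>{1..n}. \<eta> x = 2} > 0" unfolding eq by linarith
    also have "\<dots> \<longleftrightarrow> {x\<in>{1..n}. \<eta> x = 2} \<noteq> {}" by (simp only: card_gt_0_iff) simp
    also have "\<dots> \<longleftrightarrow> (\<exists>x\<in>{1..n}. \<eta> x = 2)" by blast
    finally show "1 \<le> twos n \<eta> \<longleftrightarrow> (\<exists>x\<in>{1..n}. \<eta> x = 2)" .
  qed
  have int_r: "integrable (P t u) ?r" and int_many: "integrable (P t u) (many_twos n)"
    and int_twos: "integrable (P t u) (\<lambda>\<eta>. real_of_int (twos n \<eta>))"
    by (rule integrable_local[OF assms(2,3) local_on_twos],
        rule integrable_local[OF assms(2,3) local_on_many_twos],
        rule integrable_local[OF assms(2,3) local_on_twos])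
  have "T t (\<lambda>\<eta>. real_of_int (twos n \<eta>)) u = T t ?r u"
  proof (rule antisym)
    \<comment> \<open>The count is at most \<open>n\<close>, so its excess over the indicator is
      absorbed by \<open>n\<close> times \<open>many_twos n\<close>, whose expectation
      vanishes.\<close>
    have "T t (\<lambda>\<eta>. real_of_int (twos n \<eta>)) u \<le> T t (\<lambda>\<eta>. ?r \<eta> + real n * many_twos n \<eta>) u"
    proof (rule T_mono[OF assms(2,3) int_twos])
      show "integrable (P t u) (\<lambda>\<eta>. ?r \<eta> + real n * many_twos n \<eta>)"
        using int_r int_many by (intro Bochner_Integration.integrable_add integrable_mult_right)
      show "real_of_int (twos n \<eta>) \<le> ?r \<eta> + real n * many_twos n \<eta>" if "\<eta> \<in> space S" for \<eta>
        using ub[OF that] nn[OF that] by (auto simp: many_twos_def)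
    qed
    also have "\<dots> = T t ?r u + real n * T t (many_twos n) u"
      unfolding T_def using int_r int_many by simp
    finally show "T t (\<lambda>\<eta>. real_of_int (twos n \<eta>)) u \<le> T t ?r u" using many by simp
    show "T t ?r u \<le> T t (\<lambda>\<eta>. real_of_int (twos n \<eta>)) u"
      by (rule T_mono[OF assms(2,3) int_r int_twos]) (use nn in auto)
  qed
  also have "\<dots> = T t (\<lambda>\<eta>. of_bool (\<exists>x\<in>{1..n}. \<eta> x = 2)) u"
    by (rule T_cong[OF assms(2,3)]) (simp only: pos)
  also have "\<dots> = measure (P t u) {\<eta> \<in> space S. \<exists>x\<in>{1..n}. \<eta> x = 2}"
    by (rule measure_P[OF assms(2,3) sets_twos, symmetric])
  finally show ?thesis .
qed

end

section \<open>The duality function for the difference of the two colour projections\<close>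

definition dual_diff :: "nat \<Rightarrow> config \<Rightarrow> config \<Rightarrow> real" where
  "dual_diff n \<eta> \<zeta> = real_of_int (dual n 2 \<eta> \<zeta> - dual n 1 \<eta> \<zeta>)"

lemma real_abs_diff_le:
  "\<bar>a - b\<bar> \<le> of_bool Q \<Longrightarrow> \<bar>real_of_int a - real_of_int b\<bar> \<le> of_bool Q"
  by (cases Q; simp; linarith)

text \<open>By \<open>dual_inject\<close> and \<open>dual_exchange\<close> all terms cancel except
  those of the last bond. There each of the thresholds 1 and 2 contributes at most one occupation
  indicator per configuration, hence the factors 2.\<close>

lemma dual_diff_generators:
  assumes \<eta>: "\<eta> \<in> space (config_space C)" and \<zeta>: "\<zeta> \<in> space (config_space C')" and n: "1 \<le> n"
    and D1: "local_on C' n (dual_diff n \<eta>)" and D2: "local_on C n (\<lambda>\<xi>. dual_diff n \<xi> \<zeta>)"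
  shows "\<bar>tasep_generator \<alpha> (dual_diff n \<eta>) \<zeta> - tasep_generator \<alpha> (\<lambda>\<xi>. dual_diff n \<xi> \<zeta>) \<eta>\<bar>
    \<le> 2 * occ n \<eta> + 2 * occ n \<zeta>"
proof -
  let ?D = "dual_diff n"
  have inj: "?D \<eta> (inject \<zeta>) = ?D (inject \<eta>) \<zeta>"
    using dual_inject[OF n, of 2] dual_inject[OF n, of 1] one_less_two_enat(2) by (simp add: dual_diff_def)
  have ex: "(?D \<eta> (exchange x \<zeta>) - ?D \<eta> \<zeta>) - (?D (exchange x \<eta>) \<zeta> - ?D \<eta> \<zeta>)
      = (if x = n then ?D \<eta> (exchange n \<zeta>) - ?D (exchange n \<eta>) \<zeta> else 0)" if "x \<in> {1..n}" for x
    using that dual_exchange[of x n 2 \<eta> \<zeta>] dual_exchange[of x n 1 \<eta> \<zeta>] by (auto simp: dual_diff_def)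
  have "tasep_generator \<alpha> (?D \<eta>) \<zeta> - tasep_generator \<alpha> (\<lambda>\<xi>. ?D \<xi> \<zeta>) \<eta>
      = (\<Sum>x\<in>{1..n}. (?D \<eta> (exchange x \<zeta>) - ?D \<eta> \<zeta>) - (?D (exchange x \<eta>) \<zeta> - ?D \<eta> \<zeta>))"
    unfolding generator_local_on[OF D1 \<zeta>] generator_local_on[OF D2 \<eta>] inj
    by (simp only: sum_subtractf)
  also have "\<dots> = (\<Sum>x\<in>{1..n}. if x = n then ?D \<eta> (exchange n \<zeta>) - ?D (exchange n \<eta>) \<zeta> else 0)"
    by (rule sum.cong[OF refl ex])
  also have "\<dots> = ?D \<eta> (exchange n \<zeta>) - ?D (exchange n \<eta>) \<zeta>"
    using n by (subst sum.delta) auto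
  finally have eq: "tasep_generator \<alpha> (?D \<eta>) \<zeta> - tasep_generator \<alpha> (\<lambda>\<xi>. ?D \<xi> \<zeta>) \<eta>
      = ?D \<eta> (exchange n \<zeta>) - ?D (exchange n \<eta>) \<zeta>" .
  have "\<bar>real_of_int (dual n c (exchange n \<eta>) \<zeta>) - real_of_int (dual n c \<eta> \<zeta>)\<bar> \<le> occ n \<eta>"
    "\<bar>real_of_int (dual n c \<eta> (exchange n \<zeta>)) - real_of_int (dual n c \<eta> \<zeta>)\<bar> \<le> occ n \<zeta>" for c
    unfolding occ_def by (rule dual_exchange_last[OF n, THEN real_abs_diff_le])+
  from this[of 1] this[of 2] show ?thesis
    unfolding eq unfolding dual_diff_def of_int_diff by linarith
qed

lemma sets_below: "{\<zeta> \<in> space (config_space C). below n c \<zeta> 0 \<le> k} \<in> sets (config_space C)"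
proof -
  have "(\<lambda>\<zeta>. \<Sum>x\<in>{0<..n}. of_bool (\<zeta> x \<le> c) :: real) \<in> borel_measurable (config_space C)"
  proof (rule borel_measurable_sum)
    fix x assume "x \<in> {0<..n}"
    then have [measurable]: "Measurable.pred (config_space C) (\<lambda>\<zeta>. \<zeta> x \<le> c)"
      by (intro pred_site) auto
    show "(\<lambda>\<zeta>. of_bool (\<zeta> x \<le> c) :: real) \<in> borel_measurable (config_space C)"
      unfolding of_bool_def by measurable
  qed
  then have "(\<lambda>\<zeta>. real_of_int (below n c \<zeta> 0)) \<in> borel_measurable (config_space C)"
    unfolding below_def of_int_sum of_int_of_bool .
  then have "{\<zeta> \<in> space (config_space C). real_of_int (below n c \<zeta> 0) \<le> real_of_int k} \<in> sets (config_space C)"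
    by measurable
  then show ?thesis by (simp only: of_int_le_iff)
qed

lemma one_shock_in_space: "one_shock_config M1 M2 \<in> space (config_space {1, 2, \<infinity>})"
  by (auto simp: space_config one_shock_config_def)

lemma empty_in_space: "empty_config \<in> space (config_space {1, \<infinity>})"
  by (auto simp: space_config empty_config_def)

lemma one_shock_le:
  assumes "1 \<le> x"
  shows "one_shock_config M1 M2 x \<le> 1 \<longleftrightarrow> M1 + 1 < x \<and> x \<le> M1 + M2 + 1"
    and "one_shock_config M1 M2 x \<le> 2 \<longleftrightarrow> M1 < x \<and> x \<le> M1 + M2 + 1"
proof -
  have "\<not> (2::enat) \<le> 1" using one_less_two_enat(1) by simp
  moreover have "\<not> (\<infinity>::enat) \<le> 1" "\<not> (\<infinity>::enat) \<le> 2"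
    by (simp_all add: one_enat_def numeral_eq_enat)
  ultimately show "one_shock_config M1 M2 x \<le> 1 \<longleftrightarrow> M1 + 1 < x \<and> x \<le> M1 + M2 + 1"
    "one_shock_config M1 M2 x \<le> 2 \<longleftrightarrow> M1 < x \<and> x \<le> M1 + M2 + 1"
    using assms one_less_two_enat(2) by (auto simp: one_shock_config_def)
qed

text \<open>With \<open>k\<close> particles of \<open>\<zeta>\<close> in
  \<open>{1..M1 + M2 + 1}\<close>, \<open>dual_block\<close> gives the difference
  \<open>1 + min k M1 - min k (M1 + 1)\<close>, which is 1 for \<open>k <= M1\<close> and 0
  otherwise. The particles of \<open>\<zeta>\<close> beyond the block cancel.\<close>

lemma dual_diff_one_shock:
  assumes n: "M1 + M2 + 1 \<le> n"
  shows "dual_diff n (one_shock_config M1 M2) \<zeta> = of_bool (below (M1 + M2 + 1) 1 \<zeta> 0 \<le> int M1)"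
proof -
  let ?l = "M1 + M2 + 1"
  have K: "below n 1 \<zeta> 0 - below n 1 \<zeta> ?l = below ?l 1 \<zeta> 0"
    using below_split[of 0 ?l n 1 \<zeta>] n by simp
  have "dual n 1 (one_shock_config M1 M2) \<zeta> = int (?l - (M1 + 1)) + below n 1 \<zeta> ?l + min (below ?l 1 \<zeta> 0) (int (M1 + 1))"
    unfolding K[symmetric] by (rule dual_block) (use n one_shock_le(1) in auto)
  moreover have "dual n 2 (one_shock_config M1 M2) \<zeta> = int (?l - M1) + below n 1 \<zeta> ?l + min (below ?l 1 \<zeta> 0) (int M1)"
    unfolding K[symmetric] by (rule dual_block) (use n one_shock_le(2) in auto)
  ultimately show ?thesis
    by (auto simp: dual_diff_def min_def)
qed

lemma dual_diff_empty: "dual_diff n \<eta> empty_config = real_of_int (twos n \<eta>)"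
proof -
  have "dual n c \<eta> empty_config = below n c \<eta> 0" for c
    by (rule dual_no_particles) (simp add: empty_config_def one_enat_def)
  then show ?thesis by (simp add: dual_diff_def twos_def)
qed

text \<open>\<open>duality_error\<close> is applied in the window
  \<open>{1..M1 + M2 + 1 + k}\<close> with \<open>k\<close> tending to infinity. The left side
  converges by continuity of measure along growing windows, the right side does not depend on
  \<open>k\<close>, and the error vanishes.\<close>

theorem semigroup_duality:
  assumes A: "tasep_semigroup {1, 2, \<infinity>} \<alpha> P" and B: "tasep_semigroup {1, \<infinity>} \<alpha> P'"
    and "0 \<le> \<alpha>" and t: "0 \<le> t"
  shows "measure (P t (one_shock_config M1 M2))
      {\<eta> \<in> space (config_space {1, 2, \<infinity>}). \<exists>x\<ge>1. \<eta> x = 2}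
    = measure (P' t empty_config)
      {\<zeta> \<in> space (config_space {1, \<infinity>}). below (M1 + M2 + 1) 1 \<zeta> 0 \<le> int M1}"
proof -
  let ?u = "one_shock_config M1 M2" and ?e = empty_config and ?l = "M1 + M2 + 1"
  interpret A: tasep_semigroup "{1, 2, \<infinity>}" \<alpha> P by (rule A)
  interpret B: tasep_semigroup "{1, \<infinity>}" \<alpha> P' by (rule B)
  interpret pA: prob_space "P t ?u" by (rule A.prob_space_P[OF t one_shock_in_space])
  have u_hole: "?u x = \<infinity>" if "x > ?l" for x using that by (simp add: one_shock_config_def)
  have e_hole: "?e x = \<infinity>" if "x > ?l" for x using that by (simp add: empty_config_def)
  have l: "1 \<le> ?l" by simp
  have start: "twos n ?u \<le> 1" for n
  proof -
    have "{x\<in>{1..n}. ?u x = 2} \<subseteq> {M1 + 1}"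
    proof
      fix x assume "x \<in> {x\<in>{1..n}. ?u x = 2}"
      then have x: "1 \<le> x" "?u x = 2" by auto
      have "\<not> (2::enat) \<le> 1" using one_less_two_enat(1) by simp
      then show "x \<in> {M1 + 1}" using one_shock_le[OF x(1), of M1 M2] x(2) by auto
    qed
    then have "card {x\<in>{1..n}. ?u x = 2} \<le> card {M1 + 1}" by (intro card_mono) auto
    then show ?thesis by (simp add: twos_eq_card[OF one_shock_in_space])
  qed
  let ?a = "\<lambda>n. measure (P t ?u) {\<eta> \<in> space A.S. \<exists>x\<in>{1..n}. \<eta> x = 2}"
  let ?b = "measure (P' t ?e) {\<zeta> \<in> space B.S. below ?l 1 \<zeta> 0 \<le> int M1}"
  \<comment> \<open>Each process contributes twice the bound on the probability that the last site
    of the window is occupied.\<close>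
  have error: "\<bar>?a (?l + k) - ?b\<bar> \<le> t * (2 * (t ^ k / fact k) + 2 * (t ^ k / fact k))" for k
  proof -
    let ?n = "?l + k"
    have "local_on {1, \<infinity>} ?n (dual_diff ?n \<eta>)" for \<eta>
    proof (rule local_onI)
      fix \<zeta> \<xi> :: config assume eq: "\<And>x. 1 \<le> x \<Longrightarrow> x \<le> ?n \<Longrightarrow> \<zeta> x = \<xi> x"
      have "dual ?n c \<eta> \<zeta> = dual ?n c \<eta> \<xi>" for c by (rule dual_cong[OF refl eq])
      then show "dual_diff ?n \<eta> \<zeta> = dual_diff ?n \<eta> \<xi>" by (simp only: dual_diff_def)
    qed
    moreover have "local_on {1, 2, \<infinity>} ?n (\<lambda>\<eta>. dual_diff ?n \<eta> \<zeta>)" for \<zeta>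
    proof (rule local_onI)
      fix \<eta> \<xi> :: config assume eq: "\<And>x. 1 \<le> x \<Longrightarrow> x \<le> ?n \<Longrightarrow> \<eta> x = \<xi> x"
      have "dual ?n c \<eta> \<zeta> = dual ?n c \<xi> \<zeta>" for c by (rule dual_cong[OF eq refl])
      then show "dual_diff ?n \<eta> \<zeta> = dual_diff ?n \<xi> \<zeta>" by (simp only: dual_diff_def)
    qed
    ultimately interpret pair: tasep_pair "{1, 2, \<infinity>}" "{1, \<infinity>}" \<alpha> P P' "dual_diff ?n" ?n
      by (unfold_locales)
    \<comment> \<open>A multiple of \<open>occ\<close> is treated as a sum with one term.\<close>
    have local_occ: "local_on C ?n (\<lambda>\<xi>. 2 * occ ?n \<xi>)" for C
      using local_on_sum[of "{()}" C ?n "\<lambda>_. occ ?n" "\<lambda>_. 2"] local_on_occ[of ?n C] by simp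
    have bound: "\<bar>A.T t (\<lambda>\<eta>. dual_diff ?n \<eta> ?e) ?u - B.T t (dual_diff ?n ?u) ?e\<bar>
        \<le> t * (2 * (t ^ k / fact k) + 2 * (t ^ k / fact k))"
    proof (rule pair.duality_error[OF t one_shock_in_space empty_in_space local_occ local_occ])
      show "\<bar>pair.discrepancy \<eta> \<zeta>\<bar> \<le> 2 * occ ?n \<eta> + 2 * occ ?n \<zeta>"
        if "\<eta> \<in> space A.S" "\<zeta> \<in> space B.S" for \<eta> \<zeta>
        unfolding pair.discrepancy_def
        by (rule dual_diff_generators[OF that _ pair.D1 pair.D2]) simp
      fix s assume s: "0 \<le> s" "s \<le> t"
      have "A.T s (\<lambda>\<xi>. 2 * occ ?n \<xi>) ?u = 2 * A.T s (occ ?n) ?u"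
        unfolding A.T_def by (rule integral_mult_right_zero)
      then show "A.T s (\<lambda>\<xi>. 2 * occ ?n \<xi>) ?u \<le> 2 * (t ^ k / fact k)"
        using A.T_occ_le_horizon[OF one_shock_in_space u_hole l s, of k] by linarith
      have "B.T s (\<lambda>\<xi>. 2 * occ ?n \<xi>) ?e = 2 * B.T s (occ ?n) ?e"
        unfolding B.T_def by (rule integral_mult_right_zero)
      then show "B.T s (\<lambda>\<xi>. 2 * occ ?n \<xi>) ?e \<le> 2 * (t ^ k / fact k)"
        using B.T_occ_le_horizon[OF empty_in_space e_hole l s, of k] by linarith
    qed
    have "A.T t (\<lambda>\<eta>. dual_diff ?n \<eta> ?e) ?u = ?a ?n"
      unfolding dual_diff_empty
      by (rule A.T_twos[OF refl t one_shock_in_space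
            A.T_many_twos_eq_0[OF refl \<open>0 \<le> \<alpha>\<close> one_shock_in_space u_hole l t start]])
    moreover have "B.T t (dual_diff ?n ?u) ?e = ?b"
    proof -
      have "B.T t (dual_diff ?n ?u) ?e = B.T t (\<lambda>\<zeta>. of_bool (below ?l 1 \<zeta> 0 \<le> int M1)) ?e"
        by (rule B.T_cong[OF t empty_in_space]) (rule dual_diff_one_shock, simp)
      also have "\<dots> = ?b"
        by (rule B.measure_P[OF t empty_in_space sets_below, symmetric])
      finally show ?thesis .
    qed
    ultimately show ?thesis using bound by simp
  qed
  have to_b: "(\<lambda>k. ?a (?l + k)) \<longlonglongrightarrow> ?b"
  proof (rule LIM_zero_cancel, rule Lim_null_comparison)
    show "\<forall>\<^sub>F k in sequentially. norm (?a (?l + k) - ?b) \<le> t * (2 * (t ^ k / fact k) + 2 * (t ^ k / fact k))"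
      unfolding real_norm_def by (intro always_eventually allI error)
    have "(\<lambda>k. t * (2 * (t ^ k / fact k) + 2 * (t ^ k / fact k))) \<longlonglongrightarrow> t * (2 * 0 + 2 * 0)"
      by (intro tendsto_mult tendsto_add tendsto_const pow_fact_tendsto)
    then show "(\<lambda>k. t * (2 * (t ^ k / fact k) + 2 * (t ^ k / fact k))) \<longlonglongrightarrow> 0"
      by simp
  qed
  have "(\<lambda>k. ?a (?l + k)) \<longlonglongrightarrow> measure (P t ?u) (\<Union>k. {\<eta> \<in> space A.S. \<exists>x\<in>{1..?l + k}. \<eta> x = 2})"
  proof (rule pA.finite_Lim_measure_incseq)
    show "range (\<lambda>k. {\<eta> \<in> space A.S. \<exists>x\<in>{1..?l + k}. \<eta> x = 2}) \<subseteq> pA.events"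
      using A.sets_twos by (auto simp: A.sets_P[OF t one_shock_in_space])
    show "incseq (\<lambda>k. {\<eta> \<in> space A.S. \<exists>x\<in>{1..?l + k}. \<eta> x = 2})"
      unfolding incseq_def by fastforce
  qed
  also have "(\<Union>k. {\<eta> \<in> space A.S. \<exists>x\<in>{1..?l + k}. \<eta> x = 2}) = {\<eta> \<in> space A.S. \<exists>x\<ge>1. \<eta> x = 2}"
  proof (intro equalityI subsetI)
    fix \<eta> assume "\<eta> \<in> {\<eta> \<in> space A.S. \<exists>x\<ge>1. \<eta> x = 2}"
    then obtain x where x: "\<eta> \<in> space A.S" "x \<ge> 1" "\<eta> x = 2" by blast
    then have "\<eta> \<in> {\<eta> \<in> space A.S. \<exists>x\<in>{1..?l + x}. \<eta> x = 2}" by auto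
    then show "\<eta> \<in> (\<Union>k. {\<eta> \<in> space A.S. \<exists>x\<in>{1..?l + k}. \<eta> x = 2})" by blast
  qed auto
  finally show ?thesis by (rule LIMSEQ_unique[OF _ to_b])
qed

section \<open>From semigroups to processes\<close>

text \<open>The Markov property at time 0: since the process starts in \<open>x0\<close>, the
  conditional expectation is almost surely the constant \<open>measure (P t x0) A\<close>, and
  integrating it gives the unconditional probability.\<close>

lemma markov_process_law:
  assumes X: "markov_process M S P x0 X" and "t \<ge> 0" and A: "A \<in> sets S"
  shows "measure M (X t -` A \<inter> space M) = measure (P t x0) A"
proof -
  interpret prob_space M using X by (simp add: markov_process_def)
  have meas: "X u \<in> measurable M S" if "u \<ge> 0" for u
    using X that by (simp add: markov_process_def)
  have start: "AE \<omega> in M. X 0 \<omega> = x0"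
    using X by (simp add: markov_process_def)
  let ?G = "{X u -` A \<inter> space M | u A. 0 \<le> u \<and> u \<le> 0 \<and> A \<in> sets S}"
  let ?F = "past M S X 0"
  have G: "?G \<subseteq> sets M"
  proof
    fix B assume "B \<in> ?G"
    then obtain u A where "B = X u -` A \<inter> space M" "0 \<le> u" "A \<in> sets S" by blast
    then show "B \<in> sets M" using measurable_sets[OF meas] by simp
  qed
  have G_Pow: "?G \<subseteq> Pow (space M)" by blast
  have "subalgebra M ?F"
    unfolding subalgebra_def past_def
    using sets.sigma_sets_subset[OF G] G_Pow by (simp add: sets_measure_of space_measure_of)
  then interpret finite_measure_subalgebra M ?F
    by unfold_locales
  let ?B = "X t -` A \<inter> space M"
  have B: "?B \<in> sets M" by (rule measurable_sets[OF meas[OF \<open>t \<ge> 0\<close>] A])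
  have "AE \<omega> in M. real_cond_exp M ?F (indicator ?B) \<omega> = measure (P t (X 0 \<omega>)) A"
  proof -
    have "\<forall>s\<ge>0. \<forall>t\<ge>0. \<forall>A\<in>sets S. AE \<omega> in M.
        real_cond_exp M (past M S X s) (indicator (X (s + t) -` A \<inter> space M)) \<omega> = measure (P t (X s \<omega>)) A"
      using X unfolding markov_process_def by (elim conjE)
    from this[rule_format, OF order_refl \<open>t \<ge> 0\<close> A] show ?thesis by simp
  qed
  with start have "AE \<omega> in M. real_cond_exp M ?F (indicator ?B) \<omega> = measure (P t x0) A"
    by eventually_elim simp
  then have "(\<integral>\<omega>. real_cond_exp M ?F (indicator ?B) \<omega> \<partial>M) = (\<integral>\<omega>. measure (P t x0) A \<partial>M)"
    by (intro integral_cong_AE) auto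
  also have "\<dots> = measure (P t x0) A"
    by (simp add: prob_space)
  finally have "measure (P t x0) A = (\<integral>\<omega>. indicator ?B \<omega> \<partial>M)"
    using real_cond_exp_int(2)[of "indicator ?B"] B by (simp add: integrable_real_indicator emeasure_eq_measure)
  then show ?thesis by simp
qed

lemma half_line_open_tasepD:
  assumes "half_line_open_tasep C \<alpha> \<eta>0 M X" and C: "finite C" "1 \<in> C" "\<infinity> \<in> C"
  obtains P where "tasep_semigroup C \<alpha> P" "markov_process M (config_space C) P \<eta>0 X"
proof -
  obtain P where P: "markov_semigroup (config_space C) P"
    "\<forall>g. local_function C g \<longrightarrow> uniform_limit (space (config_space C))
       (\<lambda>h \<eta>. ((\<integral>\<xi>. g \<xi> \<partial>P h \<eta>) - g \<eta>) / h) (tasep_generator \<alpha> g) (at_right 0)"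
    "markov_process M (config_space C) P \<eta>0 X"
    using assms(1) unfolding half_line_open_tasep_def by (elim conjE exE)
  have "tasep_semigroup C \<alpha> P"
    by (rule tasep_semigroup.intro[OF C P(1)]) (rule P(2)[rule_format])
  then show ?thesis using P(3) that by blast
qed

section \<open>Events in terms of positions and particle counts\<close>

lemma second_class_position_pos: "second_class_position \<eta> > 0 \<longleftrightarrow> (\<exists>x\<ge>1. \<eta> x = 2)"
proof (cases "\<exists>x\<ge>1. \<eta> x = 2")
  case True
  then obtain x where x: "1 \<le> x \<and> \<eta> x = 2" by blast
  have "1 \<le> (LEAST x. 1 \<le> x \<and> \<eta> x = 2)"
    using LeastI[of "\<lambda>x. 1 \<le> x \<and> \<eta> x = 2", OF x] by (rule conjunct1)
  then show ?thesis using True by (simp add: second_class_position_def)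
next
  case False
  then have "second_class_position \<eta> = - 1" unfolding second_class_position_def by (rule if_not_P)
  with False show ?thesis by simp
qed

lemma second_class_position_neg: "second_class_position \<eta> < 0 \<longleftrightarrow> \<not> (\<exists>x\<ge>1. \<eta> x = 2)"
  unfolding second_class_position_def by simp

text \<open>Finiteness allows the count to be split after site \<open>l\<close>; the sites
  \<open>1..l\<close> remain, where every particle is first-class.\<close>

lemma particles_from_diff:
  assumes "\<zeta> \<in> space (config_space {1, \<infinity>})" and fin: "finite {x. 1 \<le> x \<and> \<zeta> x \<noteq> \<infinity>}"
  shows "int (particles_from 1 \<zeta>) - int (particles_from (Suc l) \<zeta>) = below l 1 \<zeta> 0"
proof -
  have le: "\<zeta> x \<le> 1 \<longleftrightarrow> \<zeta> x \<noteq> \<infinity>" if "1 \<le> x" for x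
  proof -
    have "\<zeta> x = 1 \<or> \<zeta> x = \<infinity>" using config_value[OF assms(1) that] by simp
    then show ?thesis by (auto simp: one_enat_def)
  qed
  let ?A = "{x\<in>{1..l}. \<zeta> x \<noteq> \<infinity>}" and ?B = "{x. 1 \<le> x \<and> Suc l \<le> x \<and> \<zeta> x \<noteq> \<infinity>}"
  have "{x. 1 \<le> x \<and> 1 \<le> x \<and> \<zeta> x \<noteq> \<infinity>} = ?A \<union> ?B" by auto
  then have "particles_from 1 \<zeta> = card (?A \<union> ?B)" by (simp only: particles_from_def)
  also have "\<dots> = card ?A + card ?B"
  proof (rule card_Un_disjoint)
    show "finite ?B" by (rule finite_subset[OF _ fin]) auto
  qed auto
  also have "card ?B = particles_from (Suc l) \<zeta>" by (simp only: particles_from_def)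
  finally have "int (particles_from 1 \<zeta>) - int (particles_from (Suc l) \<zeta>) = int (card ?A)" by simp
  also have "\<dots> = (\<Sum>x\<in>{0<..l}. of_bool (\<zeta> x \<noteq> \<infinity>))"
    by (simp only: sum_of_bool_eq finite_greaterThanAtMost) (intro arg_cong[where f = int] arg_cong[where f = card], auto)
  also have "\<dots> = below l 1 \<zeta> 0"
    unfolding below_def by (rule sum.cong) (use le in auto)
  finally show ?thesis .
qed

text \<open>Discarding the finitely many sites below \<open>y\<close> leaves an infinite set, whose
  \<open>card\<close> is 0 by convention.\<close>

lemma particles_from_infinite:
  assumes "infinite {x. 1 \<le> x \<and> \<zeta> x \<noteq> \<infinity>}"
  shows "particles_from y \<zeta> = 0"
proof -
  have "{x. 1 \<le> x \<and> \<zeta> x \<noteq> \<infinity>} \<subseteq> {..<y} \<union> {x. 1 \<le> x \<and> y \<le> x \<and> \<zeta> x \<noteq> \<infinity>}" by auto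
  then have "infinite {x. 1 \<le> x \<and> y \<le> x \<and> \<zeta> x \<noteq> \<infinity>}"
    using assms by (meson finite_Un finite_lessThan finite_subset)
  then show ?thesis by (simp add: particles_from_def)
qed

text \<open>A set of sites is finite iff it is bounded, which is a countable combination of
  conditions on single sites.\<close>

lemma sets_finite_particles: "{\<zeta> \<in> space (config_space C). finite {x. 1 \<le> x \<and> \<zeta> x \<noteq> \<infinity>}} \<in> sets (config_space C)"
proof -
  have "finite {x. 1 \<le> x \<and> \<zeta> x \<noteq> \<infinity>} \<longleftrightarrow> (\<exists>k. \<forall>x\<in>{k<..}. 1 \<le> x \<longrightarrow> \<zeta> x = \<infinity>)" for \<zeta> :: config
  proof
    assume "finite {x. 1 \<le> x \<and> \<zeta> x \<noteq> \<infinity>}"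
    then obtain k where "{x. 1 \<le> x \<and> \<zeta> x \<noteq> \<infinity>} \<subseteq> {..k}" using finite_nat_iff_bounded_le by blast
    then have "\<forall>x\<in>{k<..}. 1 \<le> x \<longrightarrow> \<zeta> x = \<infinity>" by (auto simp only: greaterThan_iff not_le[symmetric])
    then show "\<exists>k. \<forall>x\<in>{k<..}. 1 \<le> x \<longrightarrow> \<zeta> x = \<infinity>" ..
  next
    assume "\<exists>k. \<forall>x\<in>{k<..}. 1 \<le> x \<longrightarrow> \<zeta> x = \<infinity>"
    then obtain k where "\<forall>x\<in>{k<..}. 1 \<le> x \<longrightarrow> \<zeta> x = \<infinity>" ..
    then have "{x. 1 \<le> x \<and> \<zeta> x \<noteq> \<infinity>} \<subseteq> {..k}" by (auto simp: not_less[symmetric])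
    then show "finite {x. 1 \<le> x \<and> \<zeta> x \<noteq> \<infinity>}" by (rule finite_subset) simp
  qed
  moreover have "{\<zeta> \<in> space (config_space C). 1 \<le> x \<longrightarrow> \<zeta> x = \<infinity>} \<in> sets (config_space C)" for x
    by (cases "1 \<le> x") (simp_all add: predE pred_site)
  then have "{\<zeta> \<in> space (config_space C). \<exists>k. \<forall>x\<in>{k<..}. 1 \<le> x \<longrightarrow> \<zeta> x = \<infinity>} \<in> sets (config_space C)"
    by (intro sets.sets_Collect_countable_Ex sets.sets_Collect_countable_Ball) auto
  ultimately show ?thesis by simp
qed

theorem theorem3p3:
  fixes M1 M2 :: nat and \<alpha> t :: real
    and \<Omega> :: "'a measure" and \<eta> :: "real \<Rightarrow> 'a \<Rightarrow> config"
    and \<Omega>' :: "'b measure" and \<zeta> :: "real \<Rightarrow> 'b \<Rightarrow> config"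
  defines "f \<equiv> \<lambda>s \<omega>. second_class_position (\<eta> s \<omega>)"
    and "N \<equiv> \<lambda>x s \<omega>. int (particles_from x (\<zeta> s \<omega>))"
  assumes "M1 \<ge> 1" and "M2 \<ge> 1" and "\<alpha> > 0" and "t \<ge> 0"
    and "half_line_open_tasep {1, 2, \<infinity>} \<alpha> (one_shock_config M1 M2) \<Omega> \<eta>"
    and "half_line_open_tasep {1, \<infinity>} \<alpha> empty_config \<Omega>' \<zeta>"
  shows "measure \<Omega> {\<omega> \<in> space \<Omega>. f t \<omega> < 0}
           = measure \<Omega>' {\<omega> \<in> space \<Omega>'. N 1 t \<omega> - N (M1 + M2 + 2) t \<omega> \<ge> int M1 + 1}
       \<and> measure \<Omega> {\<omega> \<in> space \<Omega>. f t \<omega> > 0}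
           = measure \<Omega>' {\<omega> \<in> space \<Omega>'. N 1 t \<omega> - N (M1 + M2 + 2) t \<omega> \<le> int M1}"
proof -
  let ?S = "config_space {1, 2, \<infinity>}" and ?S' = "config_space {1, \<infinity>}"
  let ?u = "one_shock_config M1 M2" and ?l = "M1 + M2 + 1"
  obtain P where P: "tasep_semigroup {1, 2, \<infinity>} \<alpha> P" and X: "markov_process \<Omega> ?S P ?u \<eta>"
    by (rule half_line_open_tasepD[OF assms(7)]) auto
  obtain P' where P': "tasep_semigroup {1, \<infinity>} \<alpha> P'" and X': "markov_process \<Omega>' ?S' P' empty_config \<zeta>"
    by (rule half_line_open_tasepD[OF assms(8)]) auto
  interpret A: tasep_semigroup "{1, 2, \<infinity>}" \<alpha> P by (rule P)
  interpret B: tasep_semigroup "{1, \<infinity>}" \<alpha> P' by (rule P')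
  interpret pA: prob_space "P t ?u" by (rule A.prob_space_P[OF \<open>t \<ge> 0\<close> one_shock_in_space])
  interpret pB: prob_space "P' t empty_config" by (rule B.prob_space_P[OF \<open>t \<ge> 0\<close> empty_in_space])
  interpret \<Omega>: prob_space \<Omega> using X by (simp add: markov_process_def)
  interpret \<Omega>': prob_space \<Omega>' using X' by (simp add: markov_process_def)
  have \<eta>_meas: "\<eta> t \<in> measurable \<Omega> ?S" and \<zeta>_meas: "\<zeta> t \<in> measurable \<Omega>' ?S'"
    using X X' \<open>t \<ge> 0\<close> by (simp_all add: markov_process_def)
  have \<eta>_space: "\<eta> t \<omega> \<in> space ?S" if "\<omega> \<in> space \<Omega>" for \<omega> by (rule measurable_space[OF \<eta>_meas that])
  have \<zeta>_space: "\<zeta> t \<omega> \<in> space ?S'" if "\<omega> \<in> space \<Omega>'" for \<omega> by (rule measurable_space[OF \<zeta>_meas that])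

  define E where "E = {\<xi> \<in> space ?S. \<exists>x\<ge>1. \<xi> x = 2}"
  define K where "K = {\<xi> \<in> space ?S'. below ?l 1 \<xi> 0 \<le> int M1}"
  define F where "F = {\<xi> \<in> space ?S'. finite {x. 1 \<le> x \<and> \<xi> x \<noteq> \<infinity>}}"
  have E: "E \<in> sets ?S"
  proof -
    have "{\<xi> \<in> space ?S. \<exists>x\<in>{1..}. \<xi> x = 2} \<in> sets ?S"
      by (intro sets.sets_Collect_countable_Bex predE pred_site) auto
    then show ?thesis by (simp only: E_def atLeast_iff Bex_def)
  qed
  have F: "F \<in> sets ?S'" unfolding F_def by (rule sets_finite_particles)
  have K: "K \<in> sets ?S'" unfolding K_def by (rule sets_below)
  have sets_eq: "sets (P' t empty_config) = sets ?S'" and space_eq: "space (P' t empty_config) = space ?S'"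
    by (rule B.sets_P[OF \<open>t \<ge> 0\<close> empty_in_space], rule B.space_P[OF \<open>t \<ge> 0\<close> empty_in_space])
  have AE_F: "AE \<xi> in P' t empty_config. \<xi> \<in> F"
  proof -
    have "AE \<xi> in P' t empty_config. finite {x. 1 \<le> x \<and> \<xi> x \<noteq> \<infinity>}"
      by (rule B.AE_finite_particles[where l = 1, OF empty_in_space]) (simp_all add: empty_config_def \<open>t \<ge> 0\<close>)
    with AE_space show ?thesis
      by eventually_elim (simp add: F_def space_eq)
  qed
  have main: "measure (P t ?u) E = measure (P' t empty_config) K"
    unfolding E_def K_def by (rule semigroup_duality[OF P P' _ \<open>t \<ge> 0\<close>]) (use \<open>\<alpha> > 0\<close> in simp)

  have "{\<omega> \<in> space \<Omega>. f t \<omega> > 0} = \<eta> t -` E \<inter> space \<Omega>"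
    using \<eta>_space by (auto simp: f_def E_def second_class_position_pos)
  then have pos: "measure \<Omega> {\<omega> \<in> space \<Omega>. f t \<omega> > 0} = measure (P t ?u) E"
    using markov_process_law[OF X \<open>t \<ge> 0\<close> E] by simp
  \<comment> \<open>The position is at least 1 or equal to -1, never 0, so this event is the
    complement of the positive one.\<close>
  have "{\<omega> \<in> space \<Omega>. f t \<omega> < 0} = \<eta> t -` (space ?S - E) \<inter> space \<Omega>"
    using \<eta>_space by (auto simp: f_def E_def second_class_position_neg)
  then have "measure \<Omega> {\<omega> \<in> space \<Omega>. f t \<omega> < 0} = measure (P t ?u) (space ?S - E)"
    using markov_process_law[OF X \<open>t \<ge> 0\<close> sets.compl_sets[OF E]] by simp
  also have "\<dots> = 1 - measure (P t ?u) E"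
    using pA.prob_compl[of E] E A.sets_P[OF \<open>t \<ge> 0\<close> one_shock_in_space]
      A.space_P[OF \<open>t \<ge> 0\<close> one_shock_in_space] by simp
  finally have neg: "measure \<Omega> {\<omega> \<in> space \<Omega>. f t \<omega> < 0} = 1 - measure (P t ?u) E" .

  \<comment> \<open>Off the almost sure event \<open>F\<close> both counts are the cardinality 0 of an infinite set.\<close>
  have N: "N 1 t \<omega> - N (M1 + M2 + 2) t \<omega> = (if \<zeta> t \<omega> \<in> F then below ?l 1 (\<zeta> t \<omega>) 0 else 0)"
    if "\<omega> \<in> space \<Omega>'" for \<omega>
  proof (cases "\<zeta> t \<omega> \<in> F")
    case True
    then have "finite {x. 1 \<le> x \<and> \<zeta> t \<omega> x \<noteq> \<infinity>}" by (simp add: F_def)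
    \<comment> \<open>Here \<open>M1 + M2 + 2\<close> is the site following the block end
      \<open>M1 + M2 + 1\<close>.\<close>
    from particles_from_diff[OF \<zeta>_space[OF that] this, of ?l] show ?thesis
      using True by (simp add: N_def)
  next
    case False
    then have "infinite {x. 1 \<le> x \<and> \<zeta> t \<omega> x \<noteq> \<infinity>}" using \<zeta>_space[OF that] by (simp add: F_def)
    from particles_from_infinite[OF this] show ?thesis using False by (simp add: N_def)
  qed
  \<comment> \<open>Off \<open>F\<close> the difference is 0 and hence at most \<open>M1\<close>;
    these outcomes belong to the event but have probability 0.\<close>
  have "{\<omega> \<in> space \<Omega>'. N 1 t \<omega> - N (M1 + M2 + 2) t \<omega> \<le> int M1}
      = \<zeta> t -` (K \<union> (space ?S' - F)) \<inter> space \<Omega>'"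
    using N \<zeta>_space by (auto simp: K_def)
  then have "measure \<Omega>' {\<omega> \<in> space \<Omega>'. N 1 t \<omega> - N (M1 + M2 + 2) t \<omega> \<le> int M1}
      = measure (P' t empty_config) (K \<union> (space ?S' - F))"
    using markov_process_law[OF X' \<open>t \<ge> 0\<close>, of "K \<union> (space ?S' - F)"] K F by simp
  also have "\<dots> = measure (P' t empty_config) K"
    by (rule pB.finite_measure_eq_AE) (use AE_F K F in \<open>auto simp: sets_eq\<close>)
  finally have le: "measure \<Omega>' {\<omega> \<in> space \<Omega>'. N 1 t \<omega> - N (M1 + M2 + 2) t \<omega> \<le> int M1}
      = measure (P' t empty_config) K" .
  \<comment> \<open>Here the outcomes off \<open>F\<close> are excluded, since 0 is less than
    \<open>M1 + 1\<close>.\<close>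
  have "{\<omega> \<in> space \<Omega>'. N 1 t \<omega> - N (M1 + M2 + 2) t \<omega> \<ge> int M1 + 1}
      = \<zeta> t -` ((space ?S' - K) \<inter> F) \<inter> space \<Omega>'"
    using N \<zeta>_space by (auto simp: K_def split: if_splits)
  then have "measure \<Omega>' {\<omega> \<in> space \<Omega>'. N 1 t \<omega> - N (M1 + M2 + 2) t \<omega> \<ge> int M1 + 1}
      = measure (P' t empty_config) ((space ?S' - K) \<inter> F)"
    using markov_process_law[OF X' \<open>t \<ge> 0\<close>, of "(space ?S' - K) \<inter> F"] K F by simp
  also have "\<dots> = measure (P' t empty_config) (space ?S' - K)"
    by (rule pB.finite_measure_eq_AE) (use AE_F K F in \<open>auto simp: sets_eq\<close>)
  also have "\<dots> = 1 - measure (P' t empty_config) K"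
    using pB.prob_compl[of K] K by (simp add: sets_eq space_eq)
  finally have ge: "measure \<Omega>' {\<omega> \<in> space \<Omega>'. N 1 t \<omega> - N (M1 + M2 + 2) t \<omega> \<ge> int M1 + 1}
      = 1 - measure (P' t empty_config) K" .
  show ?thesis unfolding pos neg le ge main by simp
qed

end
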